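(* Let $E$ and $F$ be complex Banach spaces, let $U$ be an open subset of $E$, let $p\in[1,\infty)$ and let $f\in\mathcal{H}^\infty(U,F)$. The following conditions are equivalent: (i) $f\colon U\to F$ has relatively $p$-compact range. (ii) The transpose $f^t\colon F^*\to\mathcal{H}^\infty(U)$ is a quasi $p$-nuclear operator. In this case, $k_p^{\mathcal{H}^\infty}(f)=\nu_p^{\mathcal{Q}}(f^t)$.
   Context: $\mathcal{H}^\infty(U,F)$ is the Banach space of all bounded holomorphic mappings $f\colon U\to F$ with the supremum norm $\|\cdot\|_\infty$, and $\mathcal{H}^\infty(U)=\mathcal{H}^\infty(U,\mathbb{C})$. The transpose of $f\in\mathcal{H}^\infty(U,F)$ is the bounded linear operator $f^t\colon F^*\to\mathcal{H}^\infty(U)$, $f^t(y^* )=y^*\circ f$. $B_X$ is the closed unit ball of $X$. For $1<p<\infty$ put $p^*=p/(p-1)$ and, for $(x_n)\in\ell_p(F)$ (absolutely $p$-summable sequences in $F$, with norm $\|(x_n)\|_p=(\sum_n\|x_n\|^p)^{1/p}$), $p\text{-}\mathrm{conv}(x_n)=\{\sum_{n=1}^\infty a_nx_n\colon (a_n)\in B_{\ell_{p^*}}\}$; for $p=1$ and $(x_n)\in\ell_1(F)$, $1\text{-}\mathrm{conv}(x_n)=\{\sum_{n=1}^\infty a_nx_n\colon (a_n)\in B_{c_0}\}$. A set $K\subseteq F$ is relatively $p$-compact if $K\subseteq p\text{-}\mathrm{conv}(x_n)$ for some $(x_n)\in\ell_p(F)$; then $m_p(K)$ is the infimum of $\|(x_n)\|_p$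 over all such sequences. A holomorphic $f\colon U\to F$ has relatively $p$-compact range if $f(U)$ is relatively $p$-compact in $F$, and then $k_p^{\mathcal{H}^\infty}(f)=m_p(f(U))$. A bounded linear operator $T\colon X\to Y$ between Banach spaces is quasi $p$-nuclear if there is a sequence $(x_n^* )\in\ell_p(X^* )$ such that $\|T(x)\|\le(\sum_{n=1}^\infty|x_n^*(x)|^p)^{1/p}$ for all $x\in X$; $\nu_p^{\mathcal{Q}}(T)$ is the infimum of $\|(x_n^* )\|_p$ over all such sequences. *)

theory Defs
  imports "HOL-Analysis.Analysis"
begin

section \<open>Complex normed spaces\<close>

class complex_vector = real_vector +
  fixes scaleC :: "complex \<Rightarrow> 'a \<Rightarrow> 'a" (infixr \<open>*\<^sub>C\<close> 75)
  assumes scaleC_add_right: "c *\<^sub>C (x + y) = c *\<^sub>C x + c *\<^sub>C y"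
    and scaleC_add_left: "(c + d) *\<^sub>C x = c *\<^sub>C x + d *\<^sub>C x"
    and scaleC_scaleC: "c *\<^sub>C (d *\<^sub>C x) = (c * d) *\<^sub>C x"
    and scaleC_one: "1 *\<^sub>C x = x"
    and scaleR_scaleC: "r *\<^sub>R x = complex_of_real r *\<^sub>C x"

class complex_normed_vector = complex_vector + real_normed_vector +
  assumes norm_scaleC: "norm (c *\<^sub>C x) = norm c * norm x"

class complex_banach = complex_normed_vector + banach

instantiation complex :: complex_banach
begin

definition scaleC_complex :: "complex \<Rightarrow> complex \<Rightarrow> complex"
  where "scaleC_complex c x = c * x"

instance
  by standard (auto simp: scaleC_complex_def algebra_simps norm_mult scaleR_conv_of_real)

end

lemma scaleC_zero_right [simp]: "c *\<^sub>C (0::'a::complex_vector) = 0"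
  using scaleC_add_right[of c 0 "0::'a"] by simp

lemma scaleC_zero_left [simp]: "0 *\<^sub>C (x::'a::complex_vector) = 0"
  using scaleC_add_left[of 0 0 x] by simp

lemma bounded_linear_scaleC: "bounded_linear (\<lambda>x::'a::complex_normed_vector. c *\<^sub>C x)"
  by (rule bounded_linear_intro[where K = "norm c"])
    (auto simp: scaleC_add_right scaleR_scaleC scaleC_scaleC mult.commute norm_scaleC)

definition bounded_clinear :: "('a::complex_normed_vector \<Rightarrow> 'b::complex_normed_vector) \<Rightarrow> bool"
  where "bounded_clinear T \<longleftrightarrow> bounded_linear T \<and> (\<forall>c x. T (c *\<^sub>C x) = c *\<^sub>C T x)"


section \<open>The dual space\<close>

text \<open>The norm of the dual is the operator norm, inherited from the type of bounded real-linear maps.\<close>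

typedef (overloaded) 'a cdual = "{f :: 'a::complex_normed_vector \<Rightarrow>\<^sub>L complex.
    \<forall>c x. blinfun_apply f (c *\<^sub>C x) = c * blinfun_apply f x}"
  morphisms blinfun_of_cdual Abs_cdual
  by (rule exI[of _ 0]) simp

setup_lifting type_definition_cdual

lift_definition cdual_apply :: "'a::complex_normed_vector cdual \<Rightarrow> 'a \<Rightarrow> complex" is blinfun_apply .

lemma cdual_eqI: "(\<And>x. cdual_apply f x = cdual_apply g x) \<Longrightarrow> f = g"
  by transfer (rule blinfun_eqI)

instantiation cdual :: (complex_normed_vector) complex_normed_vector
begin

lift_definition zero_cdual :: "'a cdual" is 0 by simp
lift_definition plus_cdual :: "'a cdual \<Rightarrow> 'a cdual \<Rightarrow> 'a cdual" is "(+)"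
  by (simp add: blinfun.add_left algebra_simps)
lift_definition minus_cdual :: "'a cdual \<Rightarrow> 'a cdual \<Rightarrow> 'a cdual" is "(-)"
  by (simp add: blinfun.diff_left algebra_simps)
lift_definition uminus_cdual :: "'a cdual \<Rightarrow> 'a cdual" is uminus
  by (simp add: blinfun.minus_left)
lift_definition scaleR_cdual :: "real \<Rightarrow> 'a cdual \<Rightarrow> 'a cdual" is scaleR
  by (simp add: blinfun.scaleR_left)
lift_definition scaleC_cdual :: "complex \<Rightarrow> 'a cdual \<Rightarrow> 'a cdual"
  is "\<lambda>c f. blinfun_compose (Blinfun ((*) c)) f"
  by (simp add: bounded_linear_Blinfun_apply bounded_linear_mult_right)
lift_definition norm_cdual :: "'a cdual \<Rightarrow> real" is norm .

lemma cdual_apply_simps: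
  "cdual_apply 0 x = 0"
  "cdual_apply (f + g) x = cdual_apply f x + cdual_apply g x"
  "cdual_apply (f - g) x = cdual_apply f x - cdual_apply g x"
  "cdual_apply (- f) x = - cdual_apply f x"
  "cdual_apply (r *\<^sub>R f) x = r *\<^sub>R cdual_apply f x"
  "cdual_apply (c *\<^sub>C f) x = c * cdual_apply f x"
  by (transfer, simp add: blinfun.bilinear_simps bounded_linear_Blinfun_apply
    bounded_linear_mult_right)+

definition dist_cdual :: "'a cdual \<Rightarrow> 'a cdual \<Rightarrow> real"
  where "dist_cdual f g = norm (f - g)"
definition sgn_cdual :: "'a cdual \<Rightarrow> 'a cdual"
  where "sgn_cdual f = scaleR (inverse (norm f)) f"
definition uniformity_cdual :: "('a cdual \<times> 'a cdual) filter"
  where "uniformity_cdual = (INF e\<in>{0 <..}. principal {(x, y). dist x y < e})"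
definition open_cdual :: "'a cdual set \<Rightarrow> bool"
  where "open_cdual S = (\<forall>x\<in>S. \<forall>\<^sub>F (x', y) in uniformity. x' = x \<longrightarrow> y \<in> S)"

instance
proof
  fix c d :: complex and r s :: real and f g h :: "'a cdual"
  show "norm (c *\<^sub>C f) = norm c * norm f"
  proof transfer
    fix c and f :: "'a \<Rightarrow>\<^sub>L complex"
    have app: "blinfun_apply (blinfun_compose (Blinfun ((*) c)) f) x = c * blinfun_apply f x" for c x
      by (simp add: bounded_linear_Blinfun_apply bounded_linear_mult_right)
    have le: "norm (blinfun_compose (Blinfun ((*) c)) g) \<le> norm c * norm g"
      for c and g :: "'a \<Rightarrow>\<^sub>L complex"
      by (rule norm_blinfun_bound)
        (auto simp: bounded_linear_Blinfun_apply bounded_linear_mult_right norm_mult mult.assoc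
          intro!: mult_left_mono norm_blinfun)
    show "norm (blinfun_compose (Blinfun ((*) c)) f) = norm c * norm f"
    proof (cases "c = 0")
      case True
      then show ?thesis using le[of c f] by simp
    next
      case False
      have "f = blinfun_compose (Blinfun ((*) (inverse c))) (blinfun_compose (Blinfun ((*) c)) f)"
        using False
        by (intro blinfun_eqI) (simp add: bounded_linear_Blinfun_apply bounded_linear_mult_right)
      with le[of "inverse c" "blinfun_compose (Blinfun ((*) c)) f"]
      have "norm f \<le> norm (inverse c) * norm (blinfun_compose (Blinfun ((*) c)) f)"
        by (simp only:)
      then have "norm c * norm f \<le> norm (blinfun_compose (Blinfun ((*) c)) f)"
        using False by (simp add: norm_inverse norm_divide field_simps)
      then show ?thesis using le[of c f] by simp
    qed
  qed
  show "f + g + h = f + (g + h)" "f + g = g + f" "0 + f = f" "- f + f = 0" "f - g = f + - g"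
    "r *\<^sub>R (f + g) = r *\<^sub>R f + r *\<^sub>R g" "(r + s) *\<^sub>R f = r *\<^sub>R f + s *\<^sub>R f"
    "r *\<^sub>R s *\<^sub>R f = (r * s) *\<^sub>R f" "1 *\<^sub>R f = f"
    "c *\<^sub>C (f + g) = c *\<^sub>C f + c *\<^sub>C g" "(c + d) *\<^sub>C f = c *\<^sub>C f + d *\<^sub>C f"
    "c *\<^sub>C d *\<^sub>C f = (c * d) *\<^sub>C f" "1 *\<^sub>C f = f" "r *\<^sub>R f = complex_of_real r *\<^sub>C f"
    by (auto intro!: cdual_eqI simp: cdual_apply_simps algebra_simps scaleR_conv_of_real)
  show "norm (r *\<^sub>R f) = \<bar>r\<bar> * norm f" "(norm f = 0) = (f = 0)" "norm (f + g) \<le> norm f + norm g"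
    by (transfer, simp add: norm_triangle_ineq)+
qed (rule dist_cdual_def sgn_cdual_def uniformity_cdual_def open_cdual_def)+

end

instance cdual :: (complex_normed_vector) complex_banach
proof
  fix X :: "nat \<Rightarrow> 'a cdual"
  assume "Cauchy X"
  have dist: "dist (blinfun_of_cdual f) (blinfun_of_cdual g) = dist f g" for f g :: "'a cdual"
    by (simp add: dist_norm norm_cdual.rep_eq minus_cdual.rep_eq)
  have "Cauchy (\<lambda>n. blinfun_of_cdual (X n))"
    using \<open>Cauchy X\<close> by (simp add: Cauchy_def dist)
  then obtain g where g: "(\<lambda>n. blinfun_of_cdual (X n)) \<longlonglongrightarrow> g"
    by (auto simp: Cauchy_convergent_iff convergent_def)
  have lim: "(\<lambda>n. blinfun_apply (blinfun_of_cdual (X n)) x) \<longlonglongrightarrow> blinfun_apply g x" for x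
    by (intro tendsto_intros g)
  have "blinfun_apply g (c *\<^sub>C x) = c * blinfun_apply g x" for c x
  proof (rule LIMSEQ_unique[OF lim])
    show "(\<lambda>n. blinfun_apply (blinfun_of_cdual (X n)) (c *\<^sub>C x)) \<longlonglongrightarrow> c * blinfun_apply g x"
      using tendsto_mult[OF tendsto_const[of c] lim[of x]]
      by (simp add: blinfun_of_cdual[simplified])
  qed
  then have "g = blinfun_of_cdual (Abs_cdual g)"
    by (simp add: Abs_cdual_inverse)
  then have "dist (blinfun_of_cdual (X n)) g = dist (X n) (Abs_cdual g)" for n
    using dist[of "X n" "Abs_cdual g"] by simp
  with g have "X \<longlonglongrightarrow> Abs_cdual g"
    unfolding tendsto_iff by simp
  then show "convergent X" by (rule convergentI)
qed


section \<open>Bounded functions with the supremum norm\<close>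

typedef (overloaded) ('a, 'b) bddfun = "{f :: 'a \<Rightarrow> 'b::real_normed_vector. bounded (range f)}"
  morphisms bddfun_apply Abs_bddfun
  by (rule exI[of _ "\<lambda>_. 0"]) (auto simp: bounded_def)

setup_lifting type_definition_bddfun

lemma bddfun_eqI: "(\<And>x. bddfun_apply f x = bddfun_apply g x) \<Longrightarrow> f = g"
  by transfer auto

instantiation bddfun :: (type, complex_normed_vector) complex_normed_vector
begin

lift_definition zero_bddfun :: "('a, 'b) bddfun" is "\<lambda>_. 0"
  by (auto simp: bounded_def)
lift_definition plus_bddfun :: "('a, 'b) bddfun \<Rightarrow> ('a, 'b) bddfun \<Rightarrow> ('a, 'b) bddfun"
  is "\<lambda>f g x. f x + g x"
  by (rule bounded_plus_comp)
lift_definition minus_bddfun :: "('a, 'b) bddfun \<Rightarrow> ('a, 'b) bddfun \<Rightarrow> ('a, 'b) bddfun"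
  is "\<lambda>f g x. f x - g x"
  by (rule bounded_minus_comp)
lift_definition uminus_bddfun :: "('a, 'b) bddfun \<Rightarrow> ('a, 'b) bddfun" is "\<lambda>f x. - f x"
  by simp
lift_definition scaleR_bddfun :: "real \<Rightarrow> ('a, 'b) bddfun \<Rightarrow> ('a, 'b) bddfun"
  is "\<lambda>r f x. r *\<^sub>R f x"
  by (rule bounded_scaleR_comp)
lift_definition scaleC_bddfun :: "complex \<Rightarrow> ('a, 'b) bddfun \<Rightarrow> ('a, 'b) bddfun"
  is "\<lambda>c f x. c *\<^sub>C f x"
  using bounded_linear_image[OF _ bounded_linear_scaleC] by (fastforce simp: image_image)
lift_definition norm_bddfun :: "('a, 'b) bddfun \<Rightarrow> real" is "\<lambda>f. SUP x. norm (f x)" .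

lemmas bddfun_apply_simps = zero_bddfun.rep_eq plus_bddfun.rep_eq minus_bddfun.rep_eq
  uminus_bddfun.rep_eq scaleR_bddfun.rep_eq scaleC_bddfun.rep_eq

definition dist_bddfun :: "('a, 'b) bddfun \<Rightarrow> ('a, 'b) bddfun \<Rightarrow> real"
  where "dist_bddfun f g = norm (f - g)"
definition sgn_bddfun :: "('a, 'b) bddfun \<Rightarrow> ('a, 'b) bddfun"
  where "sgn_bddfun f = scaleR (inverse (norm f)) f"
definition uniformity_bddfun :: "(('a, 'b) bddfun \<times> ('a, 'b) bddfun) filter"
  where "uniformity_bddfun = (INF e\<in>{0 <..}. principal {(x, y). dist x y < e})"
definition open_bddfun :: "('a, 'b) bddfun set \<Rightarrow> bool"
  where "open_bddfun S = (\<forall>x\<in>S. \<forall>\<^sub>F (x', y) in uniformity. x' = x \<longrightarrow> y \<in> S)"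

lemma norm_bddfun_upper: "norm (bddfun_apply f x) \<le> norm (f :: ('a, 'b) bddfun)"
  by transfer (auto intro!: cSUP_upper bounded_imp_bdd_above simp: bounded_norm_comp)

lemma norm_bddfun_least: "(\<And>x. norm (bddfun_apply f x) \<le> b) \<Longrightarrow> norm (f :: ('a, 'b) bddfun) \<le> b"
  by transfer (auto intro!: cSUP_least)

instance
proof
  fix f g h :: "('a, 'b) bddfun" and c d :: complex and r s :: real
  have norm_scaleC_le: "norm (c *\<^sub>C f) \<le> norm c * norm f" for c and f :: "('a, 'b) bddfun"
    by (rule norm_bddfun_least)
      (simp add: scaleC_bddfun.rep_eq norm_scaleC mult_left_mono norm_bddfun_upper)
  show scale: "norm (c *\<^sub>C f) = norm c * norm f" for c and f :: "('a, 'b) bddfun"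
  proof (cases "c = 0")
    case True
    have "0 \<le> norm (c *\<^sub>C f)"
      using norm_bddfun_upper[of "c *\<^sub>C f" undefined] by (meson norm_ge_zero order_trans)
    with True norm_scaleC_le[of c f] show ?thesis by simp
  next
    case False
    have "f = inverse c *\<^sub>C (c *\<^sub>C f)"
      using False by (intro bddfun_eqI) (simp add: scaleC_bddfun.rep_eq scaleC_scaleC scaleC_one)
    with norm_scaleC_le[of "inverse c" "c *\<^sub>C f"] have "norm f \<le> norm (inverse c) * norm (c *\<^sub>C f)"
      by simp
    then have "norm c * norm f \<le> norm (c *\<^sub>C f)"
      using False by (simp add: norm_inverse norm_divide field_simps)
    then show ?thesis using norm_scaleC_le[of c f] by simp
  qed
  have RC: "r *\<^sub>R f = complex_of_real r *\<^sub>C f" for r and f :: "('a, 'b) bddfun"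
    by transfer (simp add: scaleR_scaleC)
  show "r *\<^sub>R f = complex_of_real r *\<^sub>C f" by (rule RC)
  show "norm (r *\<^sub>R f) = \<bar>r\<bar> * norm f"
    by (simp add: RC scale)
  show "norm (f + g) \<le> norm f + norm g"
    by (rule norm_bddfun_least)
      (auto simp: plus_bddfun.rep_eq intro!: norm_triangle_mono norm_bddfun_upper)
  show "(norm f = 0) = (f = 0)"
  proof
    assume "norm f = 0"
    then show "f = 0"
      using norm_bddfun_upper[of f] by (intro bddfun_eqI) (simp add: zero_bddfun.rep_eq)
  qed (simp add: norm_bddfun.rep_eq zero_bddfun.rep_eq)
  show "f + g + h = f + (g + h)" "f + g = g + f" "0 + f = f" "- f + f = 0" "f - g = f + - g"
    "r *\<^sub>R (f + g) = r *\<^sub>R f + r *\<^sub>R g" "(r + s) *\<^sub>R f = r *\<^sub>R f + s *\<^sub>R f"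
    "r *\<^sub>R s *\<^sub>R f = (r * s) *\<^sub>R f" "1 *\<^sub>R f = f"
    "c *\<^sub>C (f + g) = c *\<^sub>C f + c *\<^sub>C g" "(c + d) *\<^sub>C f = c *\<^sub>C f + d *\<^sub>C f"
    "c *\<^sub>C d *\<^sub>C f = (c * d) *\<^sub>C f" "1 *\<^sub>C f = f"
    by (auto intro!: bddfun_eqI simp: bddfun_apply_simps algebra_simps scaleC_add_right scaleC_add_left
      scaleC_scaleC scaleC_one)
qed (rule dist_bddfun_def sgn_bddfun_def uniformity_bddfun_def open_bddfun_def)+

end

instance bddfun :: (type, complex_banach) complex_banach
proof
  fix X :: "nat \<Rightarrow> ('a, 'b) bddfun"
  assume "Cauchy X"
  have le: "dist (bddfun_apply f x) (bddfun_apply g x) \<le> dist f g" for f g :: "('a, 'b) bddfun" and x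
    using norm_bddfun_upper[of "f - g" x] by (simp add: dist_norm minus_bddfun.rep_eq)
  have "Cauchy (\<lambda>n. bddfun_apply (X n) x)" for x
    using \<open>Cauchy X\<close> unfolding Cauchy_def by (meson le le_less_trans)
  then have "\<exists>g. \<forall>x. (\<lambda>n. bddfun_apply (X n) x) \<longlonglongrightarrow> g x"
    by (intro choice) (auto simp: Cauchy_convergent_iff convergent_def)
  then obtain g where g: "\<And>x. (\<lambda>n. bddfun_apply (X n) x) \<longlonglongrightarrow> g x"
    by blast
  have close: "\<exists>N. \<forall>n\<ge>N. \<forall>x. dist (bddfun_apply (X n) x) (g x) \<le> e" if e: "e > 0" for e
  proof -
    obtain N where N: "\<forall>m\<ge>N. \<forall>n\<ge>N. dist (X m) (X n) < e"
      using \<open>Cauchy X\<close> e unfolding Cauchy_def by blast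
    have "dist (bddfun_apply (X n) x) (g x) \<le> e" if "n \<ge> N" for n x
    proof (rule LIMSEQ_le_const2)
      show "(\<lambda>m. dist (bddfun_apply (X n) x) (bddfun_apply (X m) x))
          \<longlonglongrightarrow> dist (bddfun_apply (X n) x) (g x)"
        by (intro tendsto_intros g)
      show "\<exists>N. \<forall>m\<ge>N. dist (bddfun_apply (X n) x) (bddfun_apply (X m) x) \<le> e"
        using N that by (meson le less_imp_le order_trans)
    qed
    then show ?thesis by blast
  qed
  obtain N where N: "\<And>x. dist (bddfun_apply (X N) x) (g x) \<le> 1"
    using close[of 1] by auto
  have "norm (g x) \<le> norm (X N) + 1" for x
    using norm_bddfun_upper[of "X N" x] N[of x] norm_triangle_ineq2[of "g x" "bddfun_apply (X N) x"]
    by (simp add: dist_norm norm_minus_commute)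
  then have "bounded (range g)"
    by (auto intro!: boundedI)
  then have ga: "bddfun_apply (Abs_bddfun g) = g"
    by (simp add: Abs_bddfun_inverse)
  have "X \<longlonglongrightarrow> Abs_bddfun g"
  proof (rule metric_LIMSEQ_I)
    fix e :: real assume "e > 0"
    then obtain N where N: "\<forall>n\<ge>N. \<forall>x. dist (bddfun_apply (X n) x) (g x) \<le> e / 2"
      using close[of "e / 2"] by auto
    have "dist (X n) (Abs_bddfun g) \<le> e / 2" if "n \<ge> N" for n
      unfolding dist_norm
      by (rule norm_bddfun_least) (use N that in \<open>auto simp: minus_bddfun.rep_eq ga dist_norm\<close>)
    then have "\<forall>n\<ge>N. dist (X n) (Abs_bddfun g) < e"
      using \<open>e > 0\<close> by force
    then show "\<exists>N. \<forall>n\<ge>N. dist (X n) (Abs_bddfun g) < e" ..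
  qed
  then show "convergent X" by (rule convergentI)
qed


section \<open>Bounded holomorphic mappings\<close>

definition holomorphic_map ::
    "'a::complex_normed_vector set \<Rightarrow> ('a \<Rightarrow> 'b::complex_normed_vector) \<Rightarrow> bool"
  where "holomorphic_map U f \<longleftrightarrow> (\<forall>a\<in>U. \<exists>D. bounded_clinear D \<and> (f has_derivative D) (at a))"

text \<open>
  For open \<open>U\<close>, a bounded holomorphic mapping on \<open>U\<close> is represented by its extension by zero to the
  whole space; the norm of \<open>bddfun\<close> is then the supremum norm over \<open>U\<close>. Thus \<open>Hinf U\<close> is the space
  of bounded holomorphic mappings on \<open>U\<close>, realised as a subspace of a Banach space of bounded
  functions.
\<close>

definition Hinf :: "'a::complex_normed_vector set \<Rightarrow> ('a, 'b::complex_normed_vector) bddfun set"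
  where "Hinf U = {f. holomorphic_map U (bddfun_apply f) \<and> (\<forall>x. x \<notin> U \<longrightarrow> bddfun_apply f x = 0)}"

lemma bounded_linear_cdual_apply: "bounded_linear (cdual_apply y)"
  by transfer (rule blinfun.bounded_linear_right)

lemma cdual_apply_scaleC: "cdual_apply y (c *\<^sub>C x) = c * cdual_apply y x"
  by transfer simp

lift_definition transpose_map ::
    "('a, 'b::complex_normed_vector) bddfun \<Rightarrow> 'b cdual \<Rightarrow> ('a, complex) bddfun"
  is "\<lambda>f y. cdual_apply y \<circ> f"
  by (metis bounded_linear_cdual_apply bounded_linear_image image_comp)

lemma transpose_map_in_Hinf:
  assumes "f \<in> Hinf U"
  shows "transpose_map f y \<in> Hinf U"
proof -
  have "\<exists>D'. bounded_clinear D' \<and> ((\<lambda>x. cdual_apply y (bddfun_apply f x)) has_derivative D') (at a)"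
    if D: "bounded_clinear D" "(bddfun_apply f has_derivative D) (at a)" for a D
  proof (intro exI conjI)
    show "((\<lambda>x. cdual_apply y (bddfun_apply f x)) has_derivative (\<lambda>x. cdual_apply y (D x))) (at a)"
      by (rule bounded_linear.has_derivative[OF bounded_linear_cdual_apply D(2)])
    then show "bounded_clinear (\<lambda>x. cdual_apply y (D x))"
      using D(1) has_derivative_bounded_linear
      by (auto simp: bounded_clinear_def cdual_apply_scaleC scaleC_complex_def)
  qed
  then have "holomorphic_map U (bddfun_apply (transpose_map f y))"
    using assms unfolding Hinf_def holomorphic_map_def transpose_map.rep_eq comp_def by blast
  moreover have "bddfun_apply (transpose_map f y) x = 0" if "x \<notin> U" for x
    using assms that linear_0[OF bounded_linear.linear[OF bounded_linear_cdual_apply[of y]]]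
    by (simp add: Hinf_def transpose_map.rep_eq)
  ultimately show ?thesis by (simp add: Hinf_def)
qed

lemma sup_norm_Hinf:
  assumes "f \<in> Hinf U" "U \<noteq> {}"
  shows "norm f = (SUP x\<in>U. norm (bddfun_apply f x))"
proof (rule antisym)
  have bdd: "bdd_above ((\<lambda>x. norm (bddfun_apply f x)) ` U)"
    by (rule bdd_aboveI2[where M = "norm f"]) (rule norm_bddfun_upper)
  obtain u where u: "u \<in> U" using assms by blast
  show "norm f \<le> (SUP x\<in>U. norm (bddfun_apply f x))"
  proof (rule norm_bddfun_least)
    fix x
    show "norm (bddfun_apply f x) \<le> (SUP x\<in>U. norm (bddfun_apply f x))"
    proof (cases "x \<in> U")
      case False
      with assms(1) have "norm (bddfun_apply f x) = 0" by (simp add: Hinf_def)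
      also have "\<dots> \<le> norm (bddfun_apply f u)" by simp
      also have "\<dots> \<le> (SUP x\<in>U. norm (bddfun_apply f x))" by (rule cSUP_upper[OF u bdd])
      finally show ?thesis .
    qed (rule cSUP_upper[OF _ bdd])
  qed
  show "(SUP x\<in>U. norm (bddfun_apply f x)) \<le> norm f"
    using assms(2) by (intro cSUP_least norm_bddfun_upper)
qed


section \<open>Relatively p-compact sets\<close>

definition ellp :: "real \<Rightarrow> (nat \<Rightarrow> 'a::real_normed_vector) set"
  where "ellp p = {x. summable (\<lambda>n. norm (x n) powr p)}"

definition ellp_norm :: "real \<Rightarrow> (nat \<Rightarrow> 'a::real_normed_vector) \<Rightarrow> real"
  where "ellp_norm p x = (\<Sum>n. norm (x n) powr p) powr (1 / p)"

text \<open>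
  The admissible coefficient sequences: the closed unit ball of the sequence space with exponent
  \<open>p / (p - 1)\<close> if \<open>1 < p\<close>, and the closed unit ball of the space of null sequences if \<open>p = 1\<close>.
\<close>

definition conv_coeffs :: "real \<Rightarrow> (nat \<Rightarrow> complex) set"
  where "conv_coeffs p =
    (if p = 1 then {a. a \<longlonglongrightarrow> 0 \<and> (\<forall>n. norm (a n) \<le> 1)}
     else {a \<in> ellp (p / (p - 1)). ellp_norm (p / (p - 1)) a \<le> 1})"

definition p_conv :: "real \<Rightarrow> (nat \<Rightarrow> 'a::complex_normed_vector) \<Rightarrow> 'a set"
  where "p_conv p x = {y. \<exists>a\<in>conv_coeffs p. (\<lambda>n. a n *\<^sub>C x n) sums y}"

definition rel_p_compact :: "real \<Rightarrow> 'a::complex_normed_vector set \<Rightarrow> bool"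
  where "rel_p_compact p K \<longleftrightarrow> (\<exists>x\<in>ellp p. K \<subseteq> p_conv p x)"

definition m_p :: "real \<Rightarrow> 'a::complex_normed_vector set \<Rightarrow> real"
  where "m_p p K = (INF x\<in>{x \<in> ellp p. K \<subseteq> p_conv p x}. ellp_norm p x)"

definition rel_p_compact_range ::
    "real \<Rightarrow> 'a set \<Rightarrow> ('a, 'b::complex_normed_vector) bddfun \<Rightarrow> bool"
  where "rel_p_compact_range p U f \<longleftrightarrow> rel_p_compact p (bddfun_apply f ` U)"

definition k_p :: "real \<Rightarrow> 'a set \<Rightarrow> ('a, 'b::complex_normed_vector) bddfun \<Rightarrow> real"
  where "k_p p U f = m_p p (bddfun_apply f ` U)"


section \<open>Quasi p-nuclear operators\<close>

definition qn_seqs ::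
    "real \<Rightarrow> ('a::complex_normed_vector \<Rightarrow> 'b::complex_normed_vector) \<Rightarrow> (nat \<Rightarrow> 'a cdual) set"
  where "qn_seqs p T =
    {\<phi> \<in> ellp p. \<forall>x. norm (T x) \<le> (\<Sum>n. norm (cdual_apply (\<phi> n) x) powr p) powr (1 / p)}"

text \<open>The codomain of the operator is the subspace \<open>Y\<close> of the ambient space, with the inherited norm.\<close>

definition quasi_p_nuclear ::
    "real \<Rightarrow> 'b::complex_normed_vector set \<Rightarrow> ('a::complex_normed_vector \<Rightarrow> 'b) \<Rightarrow> bool"
  where "quasi_p_nuclear p Y T \<longleftrightarrow> bounded_clinear T \<and> range T \<subseteq> Y \<and> qn_seqs p T \<noteq> {}"

definition nu_Q :: "real \<Rightarrow> ('a::complex_normed_vector \<Rightarrow> 'b::complex_normed_vector) \<Rightarrow> real"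
  where "nu_Q p T = (INF \<phi>\<in>qn_seqs p T. ellp_norm p \<phi>)"

end

theory Submission
  imports Defs
begin

text \<open>
  Let \<open>K\<close> be the image of \<open>U\<close> under \<open>f\<close>. Since the norm of the transpose at a functional \<open>y\<close> is the supremum
  of \<open>\<bar>y\<bar>\<close> over \<open>K\<close>, the transpose is quasi p-nuclear if and only if there is a p-summable sequence
  \<open>\<phi>\<close> in the bidual such that \<open>\<bar>y v\<bar>\<close> is at most the p-norm of the scalar sequence \<open>\<phi> n y\<close>, for all
  \<open>v\<close> in \<open>K\<close> and all functionals \<open>y\<close>.

  If \<open>K\<close> lies in the p-convex hull of \<open>x\<close>, then Hoelder's inequality shows that the images of the
  \<open>x n\<close> in the bidual form such a sequence (\<open>p_conv_imp_dominated\<close>).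

  The converse has to replace vectors of the bidual by vectors of the space itself without losing
  more than an arbitrarily small amount of norm. By the Hahn-Banach theorem every \<open>v\<close> in \<open>K\<close> is of
  the form \<open>\<Sum>n. a n * \<phi> n\<close>, as a functional on the dual, with coefficients in the dual unit ball
  (\<open>dominated_functional_representation\<close>). For finitely many points \<open>v\<close> a second separation argument,
  in the spirit of Helly's theorem, gives vectors \<open>x n\<close> in the space itself, of norm at most
  \<open>(1 + \<theta>) * norm (\<phi> n)\<close>, for which the same coefficients reproduce these points up to a small
  error (\<open>finite_bidual_approximation\<close>).

  The passage from finitely many points to \<open>K\<close> uses that the coefficients are bounded and that
  \<open>\<phi>\<close> has small tails: \<open>K\<close> has a finite subset such that every point of \<open>K\<close> differs from one of its
  points by a vector with a small dominating sequence. Hence \<open>K\<close> is the sum of a part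
  that is represented by a finite sequence in the space, of norm almost that of \<open>\<phi>\<close>, and of a
  remainder that is dominated by a sequence of arbitrarily small norm (\<open>split_off_finite_piece\<close>). The
  remainder is split in the same way, again and again. As the remainders tend to zero, \<open>K\<close> is a
  series of finite pieces, and the sequences that represent the pieces are strung together into one
  sequence (\<open>concatenate_finite_pieces\<close>) whose norm is almost that of the first of them.
\<close>

section \<open>The Hahn-Banach theorem\<close>

definition sublinear :: "('a::real_vector \<Rightarrow> real) \<Rightarrow> bool"
  where "sublinear q \<longleftrightarrow>
    (\<forall>x y. q (x + y) \<le> q x + q y) \<and> (\<forall>c x. 0 \<le> c \<longrightarrow> q (c *\<^sub>R x) = c * q x)"

lemma sublinear_add: "sublinear q \<Longrightarrow> q (x + y) \<le> q x + q y"
  and sublinear_scaleR: "sublinear q \<Longrightarrow> 0 \<le> c \<Longrightarrow> q (c *\<^sub>R x) = c * q x"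
  and sublinear_zero: "sublinear q \<Longrightarrow> q 0 = 0"
  unfolding sublinear_def by (blast, blast, metis mult_zero_left order_refl scaleR_zero_left)

lemma sublinear_minus: "sublinear q \<Longrightarrow> - q (- x) \<le> q x"
  using sublinear_add[of q x "- x"] by (simp add: sublinear_zero)

text \<open>
  The largest sublinear functional below \<open>q\<close> that is at most \<open>t\<close> at \<open>a\<close>
  for all \<open>(a, t)\<close> in the convex cone \<open>C\<close>, if there is such a functional. Extension of
  functionals, separation of a point from a convex set and linearity of minimal sublinear functionals are all
  obtained from suitable choices of \<open>C\<close>.
\<close>

definition cone_inf :: "('a::real_vector \<Rightarrow> real) \<Rightarrow> ('a \<times> real) set \<Rightarrow> 'a \<Rightarrow> real"
  where "cone_inf q C v = (INF (a, t)\<in>C. q (v - a) + t)"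

context
  fixes q :: "'a::real_vector \<Rightarrow> real" and C :: "('a \<times> real) set"
  assumes q: "sublinear q" and C: "convex_cone C"
    and compat: "\<And>a t. (a, t) \<in> C \<Longrightarrow> 0 \<le> q (- a) + t"
begin

lemma cone_inf_bdd: "bdd_below ((\<lambda>(a, t). q (v - a) + t) ` C)"
proof (rule bdd_belowI[of _ "- q (- v)"], clarify)
  fix a t assume "(a, t) \<in> C"
  then have "0 \<le> q (- a) + t" by (rule compat)
  also have "q (- a) \<le> q (v - a) + q (- v)"
    using sublinear_add[OF q, of "v - a" "- v"] by simp
  finally show "- q (- v) \<le> q (v - a) + t" by simp
qed

lemma cone_inf_le: "(a, t) \<in> C \<Longrightarrow> cone_inf q C v \<le> q (v - a) + t"
  unfolding cone_inf_def by (rule cINF_lower2[OF cone_inf_bdd]) auto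

lemma cone_inf_greatest: "(\<And>a t. (a, t) \<in> C \<Longrightarrow> m \<le> q (v - a) + t) \<Longrightarrow> m \<le> cone_inf q C v"
  unfolding cone_inf_def using C by (intro cINF_greatest) (auto simp: convex_cone_def)

lemma cone_inf_le_base: "cone_inf q C v \<le> q v"
  using cone_inf_le[of 0 0 v] convex_cone_contains_0[OF C] by (simp add: zero_prod_def)

lemma cone_inf_le_height: "(a, t) \<in> C \<Longrightarrow> cone_inf q C a \<le> t"
  using cone_inf_le[of a t a] by (simp add: sublinear_zero[OF q])

lemma sublinear_cone_inf: "sublinear (cone_inf q C)"
proof -
  have add: "cone_inf q C (x + y) \<le> cone_inf q C x + cone_inf q C y" for x y
  proof -
    have *: "cone_inf q C (x + y) - (q (y - b) + u) \<le> cone_inf q C x" if bu: "(b, u) \<in> C" for b u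
    proof (rule cone_inf_greatest)
      fix a t assume "(a, t) \<in> C"
      with bu have "(a + b, t + u) \<in> C"
        using convex_cone_add[OF C, of "(a, t)" "(b, u)"] by simp
      then have "cone_inf q C (x + y) \<le> q (x + y - (a + b)) + (t + u)" by (rule cone_inf_le)
      also have "q (x + y - (a + b)) \<le> q (x - a) + q (y - b)"
        using sublinear_add[OF q, of "x - a" "y - b"] by (simp add: algebra_simps)
      finally show "cone_inf q C (x + y) - (q (y - b) + u) \<le> q (x - a) + t" by simp
    qed
    have "cone_inf q C (x + y) - cone_inf q C x \<le> cone_inf q C y"
      by (rule cone_inf_greatest) (use * in \<open>force simp: algebra_simps\<close>)
    then show ?thesis by simp
  qed
  have le: "cone_inf q C (c *\<^sub>R x) \<le> c * cone_inf q C x" if c: "0 < c" for c x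
  proof -
    have "cone_inf q C (c *\<^sub>R x) / c \<le> cone_inf q C x"
    proof (rule cone_inf_greatest)
      fix a t assume "(a, t) \<in> C"
      then have "(c *\<^sub>R a, c * t) \<in> C"
        using C c by (auto simp: convex_cone_def conic_def)
      then have "cone_inf q C (c *\<^sub>R x) \<le> q (c *\<^sub>R x - c *\<^sub>R a) + c * t" by (rule cone_inf_le)
      also have "q (c *\<^sub>R x - c *\<^sub>R a) = c * q (x - a)"
        using sublinear_scaleR[OF q, of c "x - a"] c by (simp add: algebra_simps)
      finally show "cone_inf q C (c *\<^sub>R x) / c \<le> q (x - a) + t"
        using c by (simp add: field_simps)
    qed
    then show ?thesis using c by (simp add: field_simps)
  qed
  have zero: "cone_inf q C 0 = 0"
    using cone_inf_le_base[of 0] cone_inf_greatest[of 0 0] compat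
    by (force simp: sublinear_zero[OF q] intro!: antisym)
  have "cone_inf q C (c *\<^sub>R x) = c * cone_inf q C x" if "0 \<le> c" for c x
  proof (cases "c = 0")
    case False
    with that have c: "0 < c" by simp
    have "c * cone_inf q C x \<le> cone_inf q C (c *\<^sub>R x)"
      using le[of "inverse c" "c *\<^sub>R x"] c by (simp add: field_simps)
    with le[OF c] show ?thesis by (rule antisym)
  qed (simp add: zero)
  with add show ?thesis by (simp add: sublinear_def)
qed

end

lemma convex_cone_ray:
  "convex_cone ((\<lambda>c. c *\<^sub>R z) ` {0..})" for z :: "'a::real_vector"
  unfolding convex_cone_iff
proof (intro conjI ballI allI impI)
  show "0 \<in> (\<lambda>c. c *\<^sub>R z) ` {0..}" by (auto intro!: image_eqI[of _ _ 0])
qed (auto simp flip: scaleR_add_left)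

text \<open>
  Pushing \<open>p\<close> down to the value \<open>- p u\<close> at \<open>- u\<close> gives a sublinear
  functional below \<open>p\<close>, hence \<open>p\<close> itself by minimality. So \<open>p\<close> is odd,
  and an odd sublinear functional is linear.
\<close>

lemma minimal_sublinear_linear:
  assumes p: "sublinear p" and min: "\<And>r. sublinear r \<Longrightarrow> (\<And>v. r v \<le> p v) \<Longrightarrow> r = p"
  shows "linear p"
proof -
  have neg: "p (- u) = - p u" for u
  proof -
    let ?C = "(\<lambda>c. c *\<^sub>R (- u, - p u)) ` {0..}"
    have compat: "0 \<le> p (- a) + t" if "(a, t) \<in> ?C" for a t
      using that by (auto simp: sublinear_scaleR[OF p])
    have "cone_inf p ?C = p"
      by (intro min sublinear_cone_inf cone_inf_le_base p convex_cone_ray compat)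
    moreover have "cone_inf p ?C (- u) \<le> - p u"
      by (intro cone_inf_le_height p convex_cone_ray compat) (auto intro!: image_eqI[of _ _ 1])
    ultimately have "p (- u) \<le> - p u" by simp
    with sublinear_minus[OF p, of "- u"] show ?thesis by simp
  qed
  show ?thesis
  proof
    fix u v
    show "p (u + v) = p u + p v"
      using sublinear_add[OF p, of u v] sublinear_add[OF p, of "u + v" "- v"] by (simp add: neg)
  next
    fix c u
    show "p (c *\<^sub>R u) = c *\<^sub>R p u"
      using sublinear_scaleR[OF p, of c u] sublinear_scaleR[OF p, of "- c" u] neg[of "c *\<^sub>R u"]
      by (cases "0 \<le> c") auto
  qed
qed

text \<open>
  Zorn's lemma gives a minimal sublinear functional below \<open>q\<close>; the infimum over a chain does not
  degenerate because every sublinear \<open>r \<le> q\<close> satisfies \<open>- q (- v) \<le> r v\<close>.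
\<close>

lemma linear_below_sublinear:
  assumes q: "sublinear q"
  shows "\<exists>\<Lambda>. linear \<Lambda> \<and> (\<forall>v. \<Lambda> v \<le> q v)"
proof -
  let ?A = "{r. sublinear r \<and> r \<le> q}"
  let ?P = "\<lambda>r s :: 'a \<Rightarrow> real. s \<le> r"
  have "\<exists>m\<in>?A. \<forall>a\<in>?A. ?P m a \<longrightarrow> a = m"
  proof (rule predicate_Zorn)
    show "partial_order_on ?A (relation_of ?P ?A)"
      by (rule partial_order_on_relation_ofI) auto
  next
    fix C assume C: "C \<in> Chains (relation_of ?P ?A)"
    have CA: "sublinear r" "r \<le> q" if "r \<in> C" for r
      using C that by (auto simp: Chains_def relation_of_def)
    have chain: "r \<le> s \<or> s \<le> r" if "r \<in> C" "s \<in> C" for r s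
      using C that by (auto simp: Chains_def relation_of_def)
    show "\<exists>u\<in>?A. \<forall>a\<in>C. ?P a u"
    proof (cases "C = {}")
      case True
      with q show ?thesis by auto
    next
      case False
      define u where "u v = (INF r\<in>C. r v)" for v
      have bdd: "bdd_below ((\<lambda>r. r v) ` C)" for v
      proof (rule bdd_belowI[of _ "- q (- v)"], clarify)
        fix r assume r: "r \<in> C"
        have "- q (- v) \<le> - r (- v)" using CA(2)[OF r] by (simp add: le_funD)
        also have "\<dots> \<le> r v" by (rule sublinear_minus[OF CA(1)[OF r]])
        finally show "- q (- v) \<le> r v" .
      qed
      have lower: "u v \<le> r v" if "r \<in> C" for r v
        unfolding u_def by (rule cINF_lower[OF bdd that])
      have greatest: "m \<le> u v" if "\<And>r. r \<in> C \<Longrightarrow> m \<le> r v" for m v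
        unfolding u_def by (rule cINF_greatest[OF False that])
      have "u (x + y) \<le> u x + u y" for x y
      proof -
        have *: "u (x + y) \<le> r x + s y" if "r \<in> C" "s \<in> C" for r s
          using chain[OF that]
        proof
          assume "r \<le> s"
          then show ?thesis
            using lower[OF that(1), of "x + y"] sublinear_add[OF CA(1)[OF that(1)], of x y]
            by (smt (verit) le_funD)
        next
          assume "s \<le> r"
          then show ?thesis
            using lower[OF that(2), of "x + y"] sublinear_add[OF CA(1)[OF that(2)], of x y]
            by (smt (verit) le_funD)
        qed
        have "u (x + y) - s y \<le> u x" if "s \<in> C" for s
          by (rule greatest) (use *[OF _ that] in \<open>simp add: algebra_simps\<close>)
        then have "u (x + y) - u x \<le> u y"
          by (intro greatest) (simp add: algebra_simps)
        then show ?thesis by simp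
      qed
      moreover have "u (c *\<^sub>R x) = c * u x" if "0 \<le> c" for c x
      proof (cases "c = 0")
        case True
        then show ?thesis
          using False by (simp add: u_def sublinear_zero[OF CA(1)] cong: INF_cong_simp)
      next
        case False
        with that have c: "0 < c" by simp
        have "u (c *\<^sub>R x) / c \<le> u x"
          by (rule greatest) (use lower[of _ "c *\<^sub>R x"] c sublinear_scaleR[OF CA(1)] in
            \<open>force simp: field_simps\<close>)
        moreover have "c * u x \<le> u (c *\<^sub>R x)"
          by (rule greatest) (use lower[of _ x] c sublinear_scaleR[OF CA(1)] in force)
        ultimately show ?thesis using c by (simp add: field_simps)
      qed
      moreover have "u \<le> q"
        using False CA(2) lower by (auto simp: le_fun_def) (meson order_trans)
      ultimately have "u \<in> ?A" by (simp add: sublinear_def)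
      then show ?thesis using lower by (auto simp: le_fun_def)
    qed
  qed
  then obtain m where m: "sublinear m" "m \<le> q"
    and min: "\<And>r. sublinear r \<Longrightarrow> r \<le> q \<Longrightarrow> r \<le> m \<Longrightarrow> r = m"
    by auto
  have "linear m"
  proof (rule minimal_sublinear_linear[OF m(1)])
    fix r assume "sublinear r" "\<And>v. r v \<le> m v"
    with m(2) show "r = m" by (intro min) (auto simp: le_fun_def intro: order_trans)
  qed
  with m show ?thesis by (auto simp: le_fun_def)
qed

text \<open>
  A linear functional below \<open>cone_inf q C\<close> satisfies all the constraints given by \<open>C\<close>.
  Adding the ray through \<open>(- v0, - cone_inf q C v0)\<close> to the constraints makes it attain the largest
  possible value at \<open>v0\<close>.
\<close>

theorem hahn_banach_cone:
  assumes q: "sublinear q" and C: "convex_cone C"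
    and compat: "\<And>a t. (a, t) \<in> C \<Longrightarrow> 0 \<le> q (- a) + t"
  obtains \<Lambda> where "linear \<Lambda>" "\<And>v. \<Lambda> v \<le> q v" "\<And>a t. (a, t) \<in> C \<Longrightarrow> \<Lambda> a \<le> t"
    "\<Lambda> v0 = cone_inf q C v0"
proof -
  define r where "r = cone_inf q C"
  have r: "sublinear r" unfolding r_def by (rule sublinear_cone_inf[OF q C compat])
  let ?D = "(\<lambda>c. c *\<^sub>R (- v0, - r v0)) ` {0..}"
  have D: "0 \<le> r (- a) + t" if "(a, t) \<in> ?D" for a t
    using that by (auto simp: sublinear_scaleR[OF r])
  obtain \<Lambda> where L: "linear \<Lambda>" "\<And>v. \<Lambda> v \<le> cone_inf r ?D v"
    using linear_below_sublinear[OF sublinear_cone_inf[of r ?D]] r convex_cone_ray D by metis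
  have Lr: "\<Lambda> v \<le> r v" for v
    using L(2)[of v] cone_inf_le_base[OF r convex_cone_ray D, where v = v] by (meson order_trans)
  have "\<Lambda> (- v0) \<le> - r v0"
    using L(2)[of "- v0"] cone_inf_le_height[OF r convex_cone_ray D, where a = "- v0" and t = "- r v0"]
    by (force intro: image_eqI[of _ _ 1])
  then have "\<Lambda> v0 = r v0"
    using Lr[of v0] by (simp add: linear_neg[OF L(1)])
  moreover have "\<Lambda> v \<le> q v" for v
    using Lr[of v] cone_inf_le_base[OF q C compat, of v] by (simp add: r_def)
  moreover have "\<Lambda> a \<le> t" if "(a, t) \<in> C" for a t
    using Lr[of a] cone_inf_le_height[OF q C compat that] by (simp add: r_def)
  ultimately show ?thesis using that L(1) by (simp add: r_def)
qed

section \<open>Finite and infinite p-norms\<close>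

definition lp_sum :: "real \<Rightarrow> 'i set \<Rightarrow> ('i \<Rightarrow> 'a::real_normed_vector) \<Rightarrow> real"
  where "lp_sum p S x = (\<Sum>i\<in>S. norm (x i) powr p) powr (1 / p)"

lemma lp_sum_nonneg: "0 \<le> lp_sum p S x"
  by (simp add: lp_sum_def)

lemma lp_sum_powr: "1 \<le> p \<Longrightarrow> lp_sum p S x powr p = (\<Sum>i\<in>S. norm (x i) powr p)"
  by (simp add: lp_sum_def powr_powr sum_nonneg)

lemma lp_sum_le_iff:
  assumes "1 \<le> p" "0 \<le> M"
  shows "lp_sum p S x \<le> M \<longleftrightarrow> (\<Sum>i\<in>S. norm (x i) powr p) \<le> M powr p"
proof -
  have "lp_sum p S x \<le> M \<longleftrightarrow> lp_sum p S x powr p \<le> M powr p"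
    using assms powr_mono2[of p "lp_sum p S x" M] powr_less_mono2[of p M "lp_sum p S x"]
      lp_sum_nonneg[of p S x] by force
  then show ?thesis by (simp add: lp_sum_powr assms)
qed

lemma lp_sum_mono:
  assumes "1 \<le> p" "\<And>i. i \<in> S \<Longrightarrow> norm (x i) \<le> norm (y i)"
  shows "lp_sum p S x \<le> lp_sum p S y"
  unfolding lp_sum_def using assms by (intro powr_mono2 sum_mono sum_nonneg) auto

lemma lp_sum_mono_set:
  assumes "1 \<le> p" "finite T" "S \<subseteq> T"
  shows "lp_sum p S x \<le> lp_sum p T x"
  unfolding lp_sum_def using assms by (intro powr_mono2 sum_mono2 sum_nonneg) auto

lemma lp_sum_scale:
  assumes "1 \<le> p"
  shows "lp_sum p S (\<lambda>i. c * x i :: real) = \<bar>c\<bar> * lp_sum p S x"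
proof -
  have "(\<bar>c\<bar> powr p * (\<Sum>i\<in>S. \<bar>x i\<bar> powr p)) powr (1 / p) =
      \<bar>c\<bar> * (\<Sum>i\<in>S. \<bar>x i\<bar> powr p) powr (1 / p)"
    using assms by (simp add: powr_mult sum_nonneg powr_powr)
  then show ?thesis
    by (simp add: lp_sum_def abs_mult powr_mult sum_distrib_left)
qed

lemma lp_sum_norm: "lp_sum p S (\<lambda>i. norm (x i)) = lp_sum p S x"
  by (simp add: lp_sum_def)

text \<open>
  With \<open>C\<close> the sum of the \<open>c i\<close>, each \<open>c i powr p\<close> is at most \<open>c i
  * C powr (p - 1)\<close>.
\<close>

lemma sum_powr_le_powr_sum:
  fixes c :: "'i \<Rightarrow> real"
  assumes "1 \<le> p" "finite S" "\<And>i. i \<in> S \<Longrightarrow> 0 \<le> c i"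
  shows "(\<Sum>i\<in>S. c i powr p) \<le> (\<Sum>i\<in>S. c i) powr p"
proof -
  define C where "C = (\<Sum>i\<in>S. c i)"
  have C: "0 \<le> C" unfolding C_def by (rule sum_nonneg) (rule assms)
  have split: "t powr p = t * t powr (p - 1)" if "0 \<le> t" for t :: real
    using that powr_mult_base[of t "p - 1"] by (cases "t = 0") auto
  have "(\<Sum>i\<in>S. c i powr p) \<le> (\<Sum>i\<in>S. c i * C powr (p - 1))"
  proof (rule sum_mono)
    fix i assume i: "i \<in> S"
    have "c i \<le> C" unfolding C_def using assms i by (intro member_le_sum) auto
    then show "c i powr p \<le> c i * C powr (p - 1)"
      using assms i by (subst split) (auto intro!: mult_left_mono powr_mono2)
  qed
  also have "\<dots> = C powr p"
    using C by (subst split) (auto simp: C_def sum_distrib_right)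
  finally show ?thesis by (simp add: C_def)
qed

lemma lp_sum_le_sum:
  assumes "1 \<le> p" "finite S"
  shows "lp_sum p S x \<le> (\<Sum>i\<in>S. norm (x i))"
  using sum_powr_le_powr_sum[of p S "\<lambda>i. norm (x i)"] assms
  by (subst lp_sum_le_iff) (auto intro: sum_nonneg)

text \<open>
  In the interior of the half-line this is the convexity of the power function; if one of the points is
  \<open>0\<close>, it follows from \<open>s powr p \<le> s\<close> for \<open>s\<close> between
  \<open>0\<close> and \<open>1\<close>.
\<close>

lemma powr_convex_nonneg:
  fixes x y t p :: real
  assumes "1 \<le> p" "0 \<le> x" "0 \<le> y" "0 \<le> t" "t \<le> 1"
  shows "((1 - t) * x + t * y) powr p \<le> (1 - t) * x powr p + t * y powr p"
proof -
  have shrink: "(s * z) powr p \<le> s * z powr p" if "0 \<le> s" "s \<le> 1" "0 \<le> z" for s z :: real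
  proof -
    have "s powr p \<le> s"
      using that assms(1) powr_mono_both'[of 1 p s s] by (cases "s = 0") auto
    then show ?thesis using that by (simp add: powr_mult mult_right_mono)
  qed
  consider "x = 0" | "y = 0" | "0 < x" "0 < y" using assms by fastforce
  then show ?thesis
  proof cases
    case 1
    then show ?thesis using shrink[of t y] assms by simp
  next
    case 2
    then show ?thesis using shrink[of "1 - t" x] assms by simp
  next
    case 3
    then show ?thesis
      using convex_onD[OF powr_convex[OF assms(1)], of t x y] assms by simp
  qed
qed

lemma lp_sum_eq_0:
  assumes "1 \<le> p" "finite S" "lp_sum p S x = 0" "i \<in> S"
  shows "x i = 0"
  using assms lp_sum_mono_set[of p S "{i}" x] by (auto simp: lp_sum_def)

text \<open>
  Minkowski's inequality. After normalisation, \<open>x + y\<close> is termwise at most a convex combination of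
  two sequences of norm \<open>1\<close>, so the convexity of the p-th power applies in each term.
\<close>

lemma lp_sum_triangle:
  assumes p: "1 \<le> p" and S: "finite S"
  shows "lp_sum p S (\<lambda>i. x i + y i) \<le> lp_sum p S x + lp_sum p S y"
proof -
  define \<alpha> \<beta> where "\<alpha> = lp_sum p S x" and "\<beta> = lp_sum p S y"
  have nonneg: "0 \<le> \<alpha>" "0 \<le> \<beta>" by (simp_all add: \<alpha>_def \<beta>_def lp_sum_nonneg)
  show ?thesis
  proof (cases "\<alpha> = 0 \<or> \<beta> = 0")
    case True
    have "(\<forall>i\<in>S. x i = 0) \<or> (\<forall>i\<in>S. y i = 0)"
      using True lp_sum_eq_0[OF p S, of x] lp_sum_eq_0[OF p S, of y] by (auto simp: \<alpha>_def \<beta>_def)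
    then have "lp_sum p S (\<lambda>i. x i + y i) \<le> \<alpha> \<or> lp_sum p S (\<lambda>i. x i + y i) \<le> \<beta>"
      using lp_sum_mono[OF p, of S "\<lambda>i. x i + y i" x] lp_sum_mono[OF p, of S "\<lambda>i. x i + y i" y]
      by (auto simp: \<alpha>_def \<beta>_def)
    then show ?thesis using nonneg unfolding \<alpha>_def \<beta>_def by linarith
  next
    case False
    with nonneg have pos: "0 < \<alpha>" "0 < \<beta>" by auto
    define t where "t = \<beta> / (\<alpha> + \<beta>)"
    have t: "0 \<le> t" "t \<le> 1" "1 - t = \<alpha> / (\<alpha> + \<beta>)" using pos by (auto simp: t_def field_simps)
    have "(\<Sum>i\<in>S. (norm (x i + y i) / (\<alpha> + \<beta>)) powr p)
        \<le> (\<Sum>i\<in>S. (1 - t) * (norm (x i) / \<alpha>) powr p + t * (norm (y i) / \<beta>) powr p)"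
    proof (rule sum_mono)
      fix i
      have "norm (x i + y i) / (\<alpha> + \<beta>) \<le> (norm (x i) + norm (y i)) / (\<alpha> + \<beta>)"
        using pos by (intro divide_right_mono norm_triangle_ineq) auto
      also have "\<dots> = (1 - t) * (norm (x i) / \<alpha>) + t * (norm (y i) / \<beta>)"
        unfolding t(3) using pos by (simp add: t_def add_divide_distrib)
      finally have "(norm (x i + y i) / (\<alpha> + \<beta>)) powr p \<le>
          ((1 - t) * (norm (x i) / \<alpha>) + t * (norm (y i) / \<beta>)) powr p"
        using pos p by (intro powr_mono2) auto
      also have "\<dots> \<le> (1 - t) * (norm (x i) / \<alpha>) powr p + t * (norm (y i) / \<beta>) powr p"
        using p pos t by (intro powr_convex_nonneg) auto
      finally show "(norm (x i + y i) / (\<alpha> + \<beta>)) powr p \<le> \<dots>" .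
    qed
    also have "\<dots> = (1 - t) * ((\<Sum>i\<in>S. norm (x i) powr p) / \<alpha> powr p)
        + t * ((\<Sum>i\<in>S. norm (y i) powr p) / \<beta> powr p)"
      using pos by (simp add: sum.distrib sum_distrib_left sum_divide_distrib powr_divide)
    also have "\<dots> = 1"
      using pos unfolding \<alpha>_def \<beta>_def lp_sum_powr[OF p, symmetric] by simp
    finally have "(\<Sum>i\<in>S. norm (x i + y i) powr p) \<le> (\<alpha> + \<beta>) powr p"
      using pos by (simp add: powr_divide flip: sum_divide_distrib)
    then show ?thesis
      using p nonneg by (subst lp_sum_le_iff) (auto simp: \<alpha>_def \<beta>_def)
  qed
qed

lemma ellp_norm_nonneg: "0 \<le> ellp_norm p x"
  by (simp add: ellp_norm_def)

lemma ellpI: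
  assumes p: "1 \<le> p" and bound: "\<And>S. finite S \<Longrightarrow> lp_sum p S x \<le> M"
  shows "x \<in> ellp p" "ellp_norm p x \<le> M"
proof -
  have M: "0 \<le> M" using bound[of "{}"] by (simp add: lp_sum_def)
  have le: "(\<Sum>n<N. norm (x n) powr p) \<le> M powr p" for N
    using bound[of "{..<N}"] lp_sum_le_iff[OF p M, of "{..<N}" x] by simp
  show x: "x \<in> ellp p"
    unfolding ellp_def using le by (auto intro!: summableI_nonneg_bounded)
  then have "(\<Sum>n. norm (x n) powr p) \<le> M powr p"
    unfolding ellp_def by (intro suminf_le_const le) simp
  then have "ellp_norm p x \<le> (M powr p) powr (1 / p)"
    unfolding ellp_norm_def using x p by (intro powr_mono2 suminf_nonneg) (auto simp: ellp_def)
  then show "ellp_norm p x \<le> M" using p M by (simp add: powr_powr)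
qed

lemma lp_sum_le_ellp_norm:
  assumes "1 \<le> p" "x \<in> ellp p" "finite S"
  shows "lp_sum p S x \<le> ellp_norm p x"
  unfolding lp_sum_def ellp_norm_def
  using assms by (intro powr_mono2 sum_le_suminf sum_nonneg) (auto simp: ellp_def)

lemma norm_le_ellp_norm:
  assumes "1 \<le> p" "x \<in> ellp p"
  shows "norm (x n) \<le> ellp_norm p x"
  using lp_sum_le_ellp_norm[OF assms, of "{n}"] assms(1) by (simp add: lp_sum_def powr_powr)

lemma ellp_dominated:
  assumes "1 \<le> p" "y \<in> ellp p" "0 \<le> c" "\<And>n. norm (x n) \<le> c * norm (y n)"
  shows "x \<in> ellp p" "ellp_norm p x \<le> c * ellp_norm p y"
proof -
  have *: "lp_sum p S x \<le> c * ellp_norm p y" if "finite S" for S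
  proof -
    have "lp_sum p S x \<le> lp_sum p S (\<lambda>n. c * norm (y n))"
      using assms by (intro lp_sum_mono) (auto simp: abs_mult)
    also have "\<dots> \<le> c * ellp_norm p y"
      using assms lp_sum_le_ellp_norm[OF assms(1,2) that]
      by (simp add: lp_sum_scale lp_sum_norm mult_left_mono)
    finally show ?thesis .
  qed
  show "x \<in> ellp p" by (rule ellpI(1)[OF assms(1) *])
  show "ellp_norm p x \<le> c * ellp_norm p y" by (rule ellpI(2)[OF assms(1) *])
qed

lemma ellp_mono:
  assumes "1 \<le> p" "y \<in> ellp p" "\<And>n. norm (x n) \<le> norm (y n)"
  shows "x \<in> ellp p" "ellp_norm p x \<le> ellp_norm p y"
  using ellp_dominated[of p y 1 x] assms by auto

lemma ellp_norm_scaleR: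
  assumes "1 \<le> p" "x \<in> ellp p" "0 \<le> c"
  shows "ellp_norm p (\<lambda>n. c *\<^sub>R x n) = c * ellp_norm p x"
proof (cases "c = 0")
  case False
  with assms have c: "0 < c" by simp
  have mem: "(\<lambda>n. c *\<^sub>R x n) \<in> ellp p" and le: "ellp_norm p (\<lambda>n. c *\<^sub>R x n) \<le> c * ellp_norm p x"
    using ellp_dominated[OF assms, of "\<lambda>n. c *\<^sub>R x n"] assms(3) by auto
  have "ellp_norm p x \<le> inverse c * ellp_norm p (\<lambda>n. c *\<^sub>R x n)"
    using c by (intro ellp_dominated(2)[OF assms(1) mem]) (simp_all flip: mult.assoc)
  with le c show ?thesis by (simp add: field_simps)
qed (use assms(1) in \<open>simp add: ellp_norm_def\<close>)

lemma ellp_add: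
  assumes "1 \<le> p" "x \<in> ellp p" "y \<in> ellp p"
  shows "(\<lambda>n. x n + y n) \<in> ellp p"
    "ellp_norm p (\<lambda>n. x n + y n) \<le> ellp_norm p x + ellp_norm p y"
proof -
  have *: "lp_sum p S (\<lambda>n. x n + y n) \<le> ellp_norm p x + ellp_norm p y" if "finite S" for S
    using lp_sum_triangle[OF assms(1) that, of x y] lp_sum_le_ellp_norm[OF assms(1,2) that]
      lp_sum_le_ellp_norm[OF assms(1,3) that] by linarith
  show "(\<lambda>n. x n + y n) \<in> ellp p" by (rule ellpI(1)[OF assms(1) *])
  show "ellp_norm p (\<lambda>n. x n + y n) \<le> ellp_norm p x + ellp_norm p y"
    by (rule ellpI(2)[OF assms(1) *])
qed

lemma ellp_norm_finite_support:
  assumes "1 \<le> p" "finite S" "\<And>n. n \<notin> S \<Longrightarrow> x n = 0"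
  shows "x \<in> ellp p" "ellp_norm p x = lp_sum p S x"
proof -
  have "(\<lambda>n. norm (x n) powr p) sums (\<Sum>n\<in>S. norm (x n) powr p)"
    using assms by (intro sums_finite) auto
  then show "x \<in> ellp p" "ellp_norm p x = lp_sum p S x"
    by (auto simp: ellp_def ellp_norm_def lp_sum_def sums_iff)
qed

lemma ellp_tail_small:
  assumes "1 \<le> p" "x \<in> ellp p" "0 < \<epsilon>"
  obtains N where "ellp_norm p (\<lambda>n. if n < N then 0 else x n) \<le> \<epsilon>"
proof -
  have sm: "summable (\<lambda>n. norm (x n) powr p)" using assms by (simp add: ellp_def)
  have "(\<lambda>N. \<Sum>n. norm (x (n + N)) powr p) \<longlonglongrightarrow> 0"
    using suminf_exist_split2[OF sm] .
  then obtain N where N: "(\<Sum>n. norm (x (n + N)) powr p) < \<epsilon> powr p"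
    using assms(3) order_tendstoD(2)[of _ 0 sequentially "\<epsilon> powr p"]
    by (auto simp: eventually_sequentially)
  let ?y = "\<lambda>n. if n < N then 0 else x n"
  have y: "(\<lambda>n. norm (?y n) powr p) sums (\<Sum>n. norm (x (n + N)) powr p)"
    using assms(1) summable_sums[OF summable_ignore_initial_segment[OF sm, of N]]
      sums_iff_shift[of "\<lambda>n. norm (?y n) powr p" N] by simp
  have "ellp_norm p ?y \<le> (\<epsilon> powr p) powr (1 / p)"
    unfolding ellp_norm_def sums_unique[OF y, symmetric] using N assms
    by (intro powr_mono2 suminf_nonneg summable_ignore_initial_segment sm) auto
  then show thesis using that assms by (simp add: powr_powr)
qed

text \<open>
  The closed unit ball of the dual of the space of p-summable scalar sequences, described by Hoelder's
  inequality on finite sets instead of by a norm with the conjugate exponent. This form is the same for \<open>p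
  = 1\<close> and \<open>p > 1\<close>, makes sense for any index type, and is evidently stable under the
  operations on coefficients that occur later.
\<close>

definition dual_ball :: "real \<Rightarrow> ('i \<Rightarrow> complex) set"
  where "dual_ball p = {a. \<forall>S v. finite S \<longrightarrow> (\<forall>i. 0 \<le> v i) \<longrightarrow>
    (\<Sum>i\<in>S. norm (a i) * v i) \<le> lp_sum p S (v :: 'i \<Rightarrow> real)}"

lemma dual_ballD:
  assumes "a \<in> dual_ball p" "finite S"
  shows "(\<Sum>i\<in>S. norm (a i) * norm (x i)) \<le> lp_sum p S x"
  using assms unfolding dual_ball_def by (force simp: lp_sum_norm[symmetric, of p S x])

lemma dual_ball_mono:
  assumes "a \<in> dual_ball p" "\<And>i. norm (b i) \<le> norm (a i)"
  shows "b \<in> dual_ball p"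
proof -
  have "(\<Sum>i\<in>S. norm (b i) * v i) \<le> (\<Sum>i\<in>S. norm (a i) * v i)" if "\<forall>i. 0 \<le> v i" for S v
    using assms(2) that by (intro sum_mono mult_right_mono) auto
  with assms(1) show ?thesis unfolding dual_ball_def by (blast intro: order_trans)
qed

lemma dual_ball_norm_le:
  assumes "a \<in> dual_ball p" "1 \<le> p"
  shows "norm (a i) \<le> 1"
  using dual_ballD[OF assms(1), of "{i}" "\<lambda>_. 1::real"] assms(2) by (simp add: lp_sum_def)

lemma dual_ball_ellp:
  assumes p: "1 \<le> p" and a: "a \<in> dual_ball p" and x: "x \<in> ellp p"
  shows "summable (\<lambda>n. norm (a n) * norm (x n))"
    "(\<Sum>n. norm (a n) * norm (x n)) \<le> ellp_norm p x"
proof -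
  have le: "(\<Sum>n<N. norm (a n) * norm (x n)) \<le> ellp_norm p x" for N
    using dual_ballD[OF a, of "{..<N}" x] lp_sum_le_ellp_norm[OF p x, of "{..<N}"] by simp
  show sm: "summable (\<lambda>n. norm (a n) * norm (x n))"
    by (rule summableI_nonneg_bounded[OF _ le]) simp
  show "(\<Sum>n. norm (a n) * norm (x n)) \<le> ellp_norm p x"
    by (rule suminf_le_const[OF sm le])
qed

text \<open>
  Hoelder's inequality; for \<open>p > 1\<close> it follows from Young's inequality after normalisation.
\<close>

lemma conv_coeffs_subset_dual_ball:
  assumes p: "1 \<le> p"
  shows "conv_coeffs p \<subseteq> dual_ball p"
proof
  fix a assume a: "a \<in> conv_coeffs p"
  have "(\<Sum>i\<in>S. norm (a i) * v i) \<le> lp_sum p S v"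
    if S: "finite S" and v: "\<And>i. 0 \<le> v i" for S and v :: "nat \<Rightarrow> real"
  proof (cases "p = 1")
    case True
    then have "(\<Sum>i\<in>S. norm (a i) * v i) \<le> (\<Sum>i\<in>S. 1 * v i)"
      using a v by (intro sum_mono mult_right_mono) (auto simp: conv_coeffs_def)
    then show ?thesis using True v by (simp add: lp_sum_def sum_nonneg)
  next
    case False
    with p have p1: "1 < p" by simp
    define q where "q = p / (p - 1)"
    have q: "1 < q" "1 / q + 1 / p = 1" using p1 by (auto simp: q_def field_simps)
    have "lp_sum q S a \<le> ellp_norm q a" "ellp_norm q a \<le> 1"
      using a False q by (auto simp: conv_coeffs_def q_def intro!: lp_sum_le_ellp_norm S)
    then have aq: "(\<Sum>i\<in>S. norm (a i) powr q) \<le> 1"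
      using q lp_sum_le_iff[of q 1 S a] by simp
    define V where "V = lp_sum p S v"
    show ?thesis
    proof (cases "V = 0")
      case True
      then have "v i = 0" if "i \<in> S" for i
        using lp_sum_eq_0[OF p S _ that, of v] by (simp add: V_def)
      then show ?thesis by (simp add: lp_sum_nonneg)
    next
      case False
      then have V: "0 < V" using lp_sum_nonneg[of p S v] by (simp add: V_def)
      have "(\<Sum>i\<in>S. norm (a i) * (v i / V)) \<le>
          (\<Sum>i\<in>S. norm (a i) powr q / q + (v i / V) powr p / p)"
        using q p1 v V by (intro sum_mono Youngs_inequality) auto
      also have "\<dots> = (\<Sum>i\<in>S. norm (a i) powr q) / q + (\<Sum>i\<in>S. norm (v i) powr p) / V powr p / p"
        using v V by (simp add: sum.distrib sum_divide_distrib powr_divide)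
      also have "\<dots> \<le> 1 / q + 1 / p"
        using divide_right_mono[OF aq, of q] q V unfolding V_def lp_sum_powr[OF p, symmetric] by simp
      finally have "(\<Sum>i\<in>S. norm (a i) * v i) / V \<le> 1"
        using q by (simp add: sum_divide_distrib)
      then show ?thesis using V by (simp add: V_def field_simps)
    qed
  qed
  then show "a \<in> dual_ball p" by (simp add: dual_ball_def)
qed

text \<open>
  The converse of Hoelder's inequality, obtained for \<open>p > 1\<close> by testing against \<open>norm (a i)
  powr (q - 1)\<close> with \<open>q\<close> the conjugate exponent. For \<open>p = 1\<close> the dual unit ball
  is the ball of the bounded sequences, so convergence to zero has to be assumed.
\<close>

lemma dual_ball_null_subset_conv_coeffs:
  assumes p: "1 \<le> p" and a: "a \<in> dual_ball p" and null: "a \<longlonglongrightarrow> 0"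
  shows "a \<in> conv_coeffs p"
proof (cases "p = 1")
  case True
  then show ?thesis using null dual_ball_norm_le[OF a p] by (simp add: conv_coeffs_def)
next
  case False
  with p have p1: "1 < p" by simp
  define q where "q = p / (p - 1)"
  have q: "1 < q" "(q - 1) * p = q" using p1 by (auto simp: q_def field_simps)
  have *: "lp_sum q S a \<le> 1" if S: "finite S" for S
  proof -
    define T where "T = (\<Sum>i\<in>S. norm (a i) powr q)"
    have T: "0 \<le> T" by (simp add: T_def sum_nonneg)
    have "norm (a i) powr q = norm (a i) * norm (a i) powr (q - 1)" for i
      using powr_mult_base[of "norm (a i)" "q - 1"] by (cases "a i = 0") auto
    then have "T = (\<Sum>i\<in>S. norm (a i) * norm (norm (a i) powr (q - 1)))"
      by (simp add: T_def)
    also have "\<dots> \<le> lp_sum p S (\<lambda>i. norm (a i) powr (q - 1))" by (rule dual_ballD[OF a S])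
    also have "\<dots> = T powr (1 / p)" by (simp add: lp_sum_def powr_powr q(2) T_def)
    finally have "T powr p \<le> T powr 1"
      using T p1 powr_mono2[of p T "T powr (1 / p)"] by (simp add: powr_powr)
    then have "T \<le> 1"
      using p1 powr_less_mono[of 1 p T] by force
    then show ?thesis using q by (subst lp_sum_le_iff) (auto simp: T_def)
  qed
  have "1 \<le> q" using q by simp
  from False ellpI(1)[OF this *] ellpI(2)[OF this *] show ?thesis by (simp add: conv_coeffs_def q_def)
qed

section \<open>The dual and the bidual\<close>

lemma linear_cdual_apply: "linear (cdual_apply y)"
  by (rule bounded_linear.linear[OF bounded_linear_cdual_apply])

lemma norm_cdual_apply_le: "norm (cdual_apply y v) \<le> norm y * norm v"
  by transfer (rule norm_blinfun)

lemma phase_exists: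
  obtains u :: complex where "norm u \<le> 1" "u * z = of_real (norm z)"
proof
  show "norm (cnj (sgn z)) \<le> 1" by (simp add: norm_sgn)
  show "cnj (sgn z) * z = of_real (norm z)"
    using complex_norm_square[of z]
    by (cases "z = 0") (simp_all add: sgn_eq power2_eq_square mult.commute divide_eq_eq)
qed

text \<open>
  Multiplying \<open>v\<close> by a number of modulus at most \<open>1\<close> turns the real part of \<open>y
  v\<close> into its modulus, so bounds on the real parts suffice.
\<close>

lemma norm_cdual_least:
  assumes "0 \<le> c" "\<And>v. Re (cdual_apply y v) \<le> c * norm v"
  shows "norm y \<le> c"
proof -
  have "norm (cdual_apply y v) \<le> c * norm v" for v
  proof -
    obtain u where u: "norm u \<le> 1" "u * cdual_apply y v = of_real (norm (cdual_apply y v))"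
      by (rule phase_exists)
    have "norm (cdual_apply y v) = Re (cdual_apply y (u *\<^sub>C v))"
      by (simp add: cdual_apply_scaleC u)
    also have "\<dots> \<le> c * (norm u * norm v)" using assms(2)[of "u *\<^sub>C v"] by (simp add: norm_scaleC)
    also have "\<dots> \<le> c * norm v" using assms(1) u(1) by (simp add: mult_left_le_one_le mult_left_mono)
    finally show ?thesis .
  qed
  with assms(1) show ?thesis by transfer (rule norm_blinfun_bound)
qed

lemma cdual_almost_attains_norm:
  assumes "0 < \<tau>"
  obtains v where "norm v \<le> 1" "norm y - \<tau> \<le> Re (cdual_apply y v)"
proof -
  have "\<exists>v. norm v \<le> 1 \<and> norm y - \<tau> \<le> Re (cdual_apply y v)"
  proof (rule ccontr)
    assume "\<not> ?thesis"
    then have less: "Re (cdual_apply y v) < norm y - \<tau>" if "norm v \<le> 1" for v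
      using that by (meson not_le)
    have c: "0 \<le> norm y - \<tau>"
      using less[of 0] by (simp add: linear_0[OF linear_cdual_apply])
    have "Re (cdual_apply y v) \<le> (norm y - \<tau>) * norm v" for v
    proof (cases "v = 0")
      case False
      have "Re (cdual_apply y (inverse (norm v) *\<^sub>R v)) < norm y - \<tau>"
        using False by (intro less) simp
      then show ?thesis
        using False by (simp add: linear_scale[OF linear_cdual_apply] field_simps)
    qed (simp add: linear_0[OF linear_cdual_apply])
    from norm_cdual_least[OF c this] assms show False by simp
  qed
  then show thesis using that by blast
qed

text \<open>
  A real-linear functional \<open>\<rho>\<close> is the real part of the complex-linear functional \<open>v
  \<mapsto> \<rho> v - \<i> * \<rho> (\<i> v)\<close>. This transfers the real Hahn-Banach theorem to complex
  spaces.
\<close>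

lemma cdual_of_real_functional:
  fixes \<rho> :: "'a::complex_normed_vector \<Rightarrow> real"
  assumes lin: "linear \<rho>" and bound: "\<And>v. \<rho> v \<le> C * norm v"
  obtains y where "\<And>v. Re (cdual_apply y v) = \<rho> v"
proof -
  define h where "h v = Complex (\<rho> v) (- \<rho> (\<i> *\<^sub>C v))" for v
  have abs: "\<bar>\<rho> v\<bar> \<le> C * norm v" for v
    using bound[of v] bound[of "- v"] by (simp add: linear_neg[OF lin])
  have C: "0 \<le> C * norm v" for v :: 'a using abs[of v] abs_ge_zero order_trans by blast
  have scaleC: "\<rho> (c *\<^sub>C v) = Re c * \<rho> v + Im c * \<rho> (\<i> *\<^sub>C v)" for c v
  proof -
    have "c *\<^sub>C v = Re c *\<^sub>R v + Im c *\<^sub>R (\<i> *\<^sub>C v)"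
      by (simp add: scaleR_scaleC scaleC_scaleC flip: scaleC_add_left)
        (metis complex_eq mult.commute)
    then show ?thesis by (simp add: linear_add[OF lin] linear_scale[OF lin])
  qed
  have i2: "\<i> *\<^sub>C (c *\<^sub>C v) = (\<i> * c) *\<^sub>C v" for c v by (simp add: scaleC_scaleC)
  have hC: "h (c *\<^sub>C v) = c * h v" for c v
    unfolding h_def i2 by (simp add: scaleC[of c] scaleC[of "\<i> * c"] complex_eq_iff algebra_simps)
  have "bounded_linear h"
  proof (rule bounded_linear_intro[where K = "2 * C"])
    show "h (u + v) = h u + h v" for u v
      by (simp add: h_def scaleC_add_right linear_add[OF lin] complex_eq_iff)
    show "h (r *\<^sub>R v) = r *\<^sub>R h v" for r v
      by (simp add: scaleR_scaleC hC scaleR_conv_of_real scaleC_complex_def)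
    show "norm (h v) \<le> norm v * (2 * C)" for v
      using abs[of v] abs[of "\<i> *\<^sub>C v"] cmod_le[of "h v"]
      unfolding h_def by (simp add: norm_scaleC algebra_simps)
  qed
  then have "cdual_apply (Abs_cdual (Blinfun h)) v = h v" for v
    by (simp add: cdual_apply_def Abs_cdual_inverse bounded_linear_Blinfun_apply hC)
  then have "Re (cdual_apply (Abs_cdual (Blinfun h)) v) = \<rho> v" for v
    by (simp add: h_def)
  then show thesis by (rule that)
qed

text \<open>
  By Hahn-Banach there is a norming functional for \<open>v\<close>.
\<close>

lemma norm_le_dual:
  fixes v :: "'a::complex_normed_vector"
  assumes "0 \<le> c" "\<And>y. norm (cdual_apply y v) \<le> c * norm y"
  shows "norm v \<le> c"
proof -
  have sub: "sublinear (norm :: 'a \<Rightarrow> real)"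
    by (simp add: sublinear_def norm_triangle_ineq)
  have cone: "convex_cone {0 :: 'a \<times> real}" by (simp add: convex_cone_iff)
  obtain \<rho> where lin: "linear \<rho>" and le: "\<And>u. \<rho> u \<le> norm u"
    and v: "\<rho> v = cone_inf norm {0} v"
    by (rule hahn_banach_cone[OF sub cone]) (auto simp: zero_prod_def)
  obtain y where y: "\<And>u. Re (cdual_apply y u) = \<rho> u"
    using cdual_of_real_functional[OF lin, of 1] le by auto
  have "norm y \<le> 1" by (rule norm_cdual_least) (simp_all add: y le)
  have "norm v = \<rho> v" by (simp add: v cone_inf_def zero_prod_def)
  also have "\<dots> \<le> norm (cdual_apply y v)" by (simp flip: y) (rule complex_Re_le_cmod)
  also have "\<dots> \<le> c * norm y" by (rule assms)
  also have "\<dots> \<le> c" using assms(1) \<open>norm y \<le> 1\<close> by (simp add: mult_left_le)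
  finally show ?thesis .
qed

text \<open>
  The canonical embedding into the bidual.
\<close>

definition evaluation :: "'a::complex_normed_vector \<Rightarrow> 'a cdual cdual"
  where "evaluation v = Abs_cdual (Blinfun (\<lambda>y. cdual_apply y v))"

lemma cdual_apply_evaluation [simp]: "cdual_apply (evaluation v) y = cdual_apply y v"
proof -
  have "bounded_linear (\<lambda>y. cdual_apply y v)"
    by (rule bounded_linear_intro[where K = "norm v"])
      (simp_all add: cdual_apply_simps norm_cdual_apply_le)
  then show ?thesis
    by (simp add: cdual_apply.rep_eq evaluation_def Abs_cdual_inverse bounded_linear_Blinfun_apply
      cdual_apply_simps[unfolded cdual_apply.rep_eq])
qed

lemma norm_evaluation_le: "norm (evaluation v) \<le> norm v"
proof (rule norm_cdual_least)
  show "Re (cdual_apply (evaluation v) y) \<le> norm v * norm y" for y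
    using complex_Re_le_cmod[of "cdual_apply y v"] norm_cdual_apply_le[of y v]
    by (simp add: mult.commute)
qed simp

lift_definition bdd_single :: "'k \<Rightarrow> 'a \<Rightarrow> ('k, 'a::real_normed_vector) bddfun"
  is "\<lambda>k v i. if i = k then v else 0"
  by (rule boundedI[where B = "norm v" for v]) auto

lemma linear_bdd_single: "linear (bdd_single k :: 'a::complex_normed_vector \<Rightarrow> _)"
  by (rule linearI; rule bddfun_eqI) (simp_all add: bddfun_apply_simps bdd_single.rep_eq)

lemma norm_bdd_single_le: "norm (bdd_single k v) \<le> norm (v :: 'a::complex_normed_vector)"
  by (rule norm_bddfun_least) (simp add: bdd_single.rep_eq)

lemma bddfun_apply_sum:
  "bddfun_apply (\<Sum>i\<in>I. f i) x = (\<Sum>i\<in>I. bddfun_apply (f i :: ('k, 'a::complex_normed_vector) bddfun) x)"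
  by (induction I rule: infinite_finite_induct) (simp_all add: bddfun_apply_simps)

lemma bddfun_apply_sum_single:
  "finite D \<Longrightarrow> bddfun_apply (\<Sum>d\<in>D. bdd_single d (z d :: 'a::complex_normed_vector)) k = (if k \<in> D then z k else 0)"
  by (simp add: bddfun_apply_sum bdd_single.rep_eq)

section \<open>Representing dominated functionals\<close>

lemma cdual_ellp:
  assumes "1 \<le> p" "\<phi> \<in> ellp p"
  shows "(\<lambda>n. cdual_apply (\<phi> n) x) \<in> ellp p"
    "ellp_norm p (\<lambda>n. cdual_apply (\<phi> n) x) \<le> norm x * ellp_norm p \<phi>"
proof -
  have le: "norm (cdual_apply (\<phi> n) x) \<le> norm x * norm (\<phi> n)" for n
    using norm_cdual_apply_le[of "\<phi> n" x] by (simp add: mult.commute)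
  show "(\<lambda>n. cdual_apply (\<phi> n) x) \<in> ellp p"
    by (rule ellp_dominated(1)[OF assms norm_ge_zero le])
  show "ellp_norm p (\<lambda>n. cdual_apply (\<phi> n) x) \<le> norm x * ellp_norm p \<phi>"
    by (rule ellp_dominated(2)[OF assms norm_ge_zero le])
qed

text \<open>
  The functional sending the sequence \<open>\<phi> n x\<close> to \<open>\<psi> x\<close> is well defined and
  bounded by the p-norm, so it extends from the sequences of this form to more general sequences, and the
  extension is given by a coefficient sequence in the dual ball.

  In order to work in one vector space, p-summable sequences are written as \<open>W b = (\<lambda>n. norm
  (\<phi> n) * b n)\<close> with bounded \<open>b\<close>: these include all sequences \<open>\<phi> n
  x\<close>, and all finitely supported sequences that vanish where \<open>\<phi> n = 0\<close>.
\<close>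

lemma dominated_functional_representation:
  fixes \<phi> :: "nat \<Rightarrow> 'x::complex_normed_vector cdual" and \<psi> :: "'x cdual"
  assumes p: "1 \<le> p" and \<phi>: "\<phi> \<in> ellp p"
    and dom: "\<And>x. norm (cdual_apply \<psi> x) \<le> ellp_norm p (\<lambda>n. cdual_apply (\<phi> n) x)"
  obtains a where "a \<in> dual_ball p" "\<And>x. (\<lambda>n. a n * cdual_apply (\<phi> n) x) sums cdual_apply \<psi> x"
proof -
  \<comment> \<open>Indices with \<open>w n = 0\<close> need no special treatment in \<open>B\<close> and \<open>a\<close>: there division by zero gives \<open>0\<close>,
    and \<open>\<phi> n = 0\<close>.\<close>
  define w where "w n = norm (\<phi> n)" for n
  define W where "W b n = w n *\<^sub>R bddfun_apply b n" for b :: "(nat, complex) bddfun" and n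
  define q where "q b = ellp_norm p (W b)" for b
  have W_add: "W (b + c) = (\<lambda>n. W b n + W c n)" for b c
    by (simp add: W_def bddfun_apply_simps algebra_simps fun_eq_iff)
  have W_scale: "W (r *\<^sub>R b) = (\<lambda>n. r *\<^sub>R W b n)" for r b
    by (simp add: W_def bddfun_apply_simps fun_eq_iff)
  have W_ellp: "W b \<in> ellp p" for b
  proof (rule ellp_dominated(1)[OF p \<phi>, of "norm b"])
    show "0 \<le> norm b" using norm_bddfun_upper[of b undefined] by (meson norm_ge_zero order_trans)
    show "norm (W b n) \<le> norm b * norm (\<phi> n)" for n
      using mult_right_mono[OF norm_bddfun_upper[of b n] norm_ge_zero[of "\<phi> n"]]
      by (simp add: W_def w_def mult.commute)
  qed
  have q: "sublinear q"
    by (simp add: sublinear_def q_def W_add W_scale ellp_add[OF p W_ellp W_ellp]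
      ellp_norm_scaleR[OF p W_ellp])
  define B where "B x = Abs_bddfun (\<lambda>n. cdual_apply (\<phi> n) x / of_real (w n))" for x
  have B_apply: "bddfun_apply (B x) n = cdual_apply (\<phi> n) x / of_real (w n)" for x n
  proof -
    have "norm (cdual_apply (\<phi> n) x / of_real (w n)) \<le> norm x" for n
      using norm_cdual_apply_le[of "\<phi> n" x]
      by (cases "w n = 0") (auto simp: w_def norm_divide divide_le_eq mult.commute)
    then have "bounded (range (\<lambda>n. cdual_apply (\<phi> n) x / of_real (w n)))"
      by (auto intro: boundedI)
    then show ?thesis by (simp add: B_def Abs_bddfun_inverse)
  qed
  have WB: "W (B x) n = cdual_apply (\<phi> n) x" for x n
    using norm_cdual_apply_le[of "\<phi> n" x]
    by (cases "w n = 0") (auto simp: W_def B_apply w_def scaleR_conv_of_real)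
  have B_lin: "linear B"
    by (rule linearI; rule bddfun_eqI)
      (simp_all add: B_apply bddfun_apply_simps linear_add[OF linear_cdual_apply]
        linear_scale[OF linear_cdual_apply] add_divide_distrib scaleR_conv_of_real)
  have \<psi>_lin: "linear (\<lambda>x. Re (cdual_apply \<psi> x))"
    by (rule linearI) (simp_all add: linear_add[OF linear_cdual_apply] linear_scale[OF linear_cdual_apply])
  define C where "C = range (\<lambda>x. (B x, Re (cdual_apply \<psi> x)))"
  have lin: "linear (\<lambda>x. (B x, Re (cdual_apply \<psi> x)))"
    by (rule linearI) (simp_all add: linear_add[OF B_lin] linear_scale[OF B_lin]
      linear_add[OF \<psi>_lin] linear_scale[OF \<psi>_lin])
  have C: "convex_cone C"
    unfolding C_def using linear_subspace_image[OF lin subspace_UNIV] by (simp add: convex_cone_iff subspace_def)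
  have compat: "0 \<le> q (- a) + t" if at: "(a, t) \<in> C" for a t
  proof -
    obtain x where x: "a = B x" "t = Re (cdual_apply \<psi> x)" using at by (auto simp: C_def)
    have "- Re (cdual_apply \<psi> x) \<le> norm (cdual_apply \<psi> (- x))"
      using abs_Re_le_cmod[of "cdual_apply \<psi> x"] by (simp add: linear_neg[OF linear_cdual_apply])
    also have "\<dots> \<le> q (B (- x))" unfolding q_def WB by (rule dom)
    finally show ?thesis by (simp add: x linear_neg[OF B_lin])
  qed
  obtain \<Lambda> where L: "linear \<Lambda>" "\<And>b. \<Lambda> b \<le> q b" "\<And>a t. (a, t) \<in> C \<Longrightarrow> \<Lambda> a \<le> t"
    using hahn_banach_cone[OF q C compat] by metis
  have LB_le: "\<Lambda> (B x) \<le> Re (cdual_apply \<psi> x)" for x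
    by (rule L(3)) (auto simp: C_def)
  have LB: "\<Lambda> (B x) = Re (cdual_apply \<psi> x)" for x
    using LB_le[of x] LB_le[of "- x"]
    by (simp add: linear_neg[OF B_lin] linear_neg[OF L(1)] linear_neg[OF linear_cdual_apply])
  have L_abs: "\<bar>\<Lambda> b\<bar> \<le> q b" for b
  proof -
    have "q (- b) = q b"
      by (simp add: q_def W_def ellp_norm_def bddfun_apply_simps)
    then show ?thesis using L(2)[of b] L(2)[of "- b"] by (simp add: linear_neg[OF L(1)])
  qed
  \<comment> \<open>Chosen such that \<open>Re (a n * c)\<close> is the value of \<open>\<Lambda>\<close> at the sequence that \<open>W\<close> maps to the
    sequence with \<open>c\<close> at index \<open>n\<close> and \<open>0\<close> elsewhere, if \<open>w n\<close> is not \<open>0\<close>.\<close>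
  define a where "a n = Complex (\<Lambda> (bdd_single n 1)) (- \<Lambda> (bdd_single n \<i>)) / of_real (w n)" for n
  have L_single: "\<Lambda> (bdd_single n c) = w n * Re (a n * c)" for n c
  proof (cases "w n = 0")
    case True
    then have "W (bdd_single n c) m = 0" for m
      by (simp add: W_def bdd_single.rep_eq)
    then have "q (bdd_single n c) = 0" by (simp add: q_def ellp_norm_def)
    then show ?thesis using L_abs[of "bdd_single n c"] True by simp
  next
    case False
    have "c = Re c *\<^sub>R 1 + Im c *\<^sub>R \<i>" by (simp add: complex_eq_iff)
    then have "bdd_single n c = Re c *\<^sub>R bdd_single n 1 + Im c *\<^sub>R bdd_single n \<i>"
      by (metis linear_add linear_scale linear_bdd_single)
    then show ?thesis
      using False by (simp add: a_def linear_add[OF L(1)] linear_scale[OF L(1)] field_simps)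
  qed
  have L_sum: "\<Lambda> (\<Sum>n\<in>S. bdd_single n (c n)) = (\<Sum>n\<in>S. w n * Re (a n * c n))" for S c
    by (simp add: linear_sum[OF L(1)] L_single)
  have ball: "a \<in> dual_ball p"
    unfolding dual_ball_def
  proof (intro CollectI allI impI)
    fix S :: "nat set" and v :: "nat \<Rightarrow> real"
    assume S: "finite S" and v: "\<forall>i. 0 \<le> v i"
    have "\<exists>u. \<forall>n. norm (u n) \<le> 1 \<and> u n * a n = of_real (norm (a n))"
      by (intro choice allI) (rule phase_exists, blast)
    then obtain u where u: "\<And>n. norm (u n) \<le> 1" "\<And>n. u n * a n = of_real (norm (a n))"
      by blast
    define c where "c n = u n * of_real (v n / w n)" for n
    have "norm (a n) * v n = w n * Re (a n * c n)" for n
    proof -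
      have "a n * c n = of_real (norm (a n) * (v n / w n))"
        using u(2)[of n] by (simp add: c_def mult.assoc[symmetric] mult.commute[of "a n"])
      then show ?thesis by (cases "w n = 0") (simp_all add: a_def)
    qed
    then have "(\<Sum>n\<in>S. norm (a n) * v n) = \<Lambda> (\<Sum>n\<in>S. bdd_single n (c n))"
      by (simp add: L_sum)
    also have "\<dots> \<le> q (\<Sum>n\<in>S. bdd_single n (c n))" by (rule L)
    also have "\<dots> = lp_sum p S (W (\<Sum>n\<in>S. bdd_single n (c n)))"
      unfolding q_def by (rule ellp_norm_finite_support[OF p S])
        (simp add: W_def bddfun_apply_sum_single[OF S])
    also have "\<dots> \<le> lp_sum p S v"
    proof (rule lp_sum_mono[OF p])
      fix n assume "n \<in> S"
      then show "norm (W (\<Sum>n\<in>S. bdd_single n (c n)) n) \<le> norm (v n)"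
        using u(1)[of n] v
        by (cases "w n = 0")
          (auto simp: W_def bddfun_apply_sum_single[OF S] c_def norm_mult norm_divide w_def mult_left_le_one_le)
    qed
    finally show "(\<Sum>n\<in>S. norm (a n) * v n) \<le> lp_sum p S v" .
  qed
  have Re_sums: "(\<lambda>n. Re (a n * cdual_apply (\<phi> n) x)) sums Re (cdual_apply \<psi> x)" for x
    unfolding sums_def
  proof (rule LIMSEQ_I)
    fix e :: real assume e: "0 < e"
    obtain N where N: "ellp_norm p (\<lambda>n. if n < N then 0 else W (B x) n) \<le> e / 2"
      using ellp_tail_small[OF p W_ellp[of "B x"], of "e / 2"] e by auto
    show "\<exists>N. \<forall>M\<ge>N. norm ((\<Sum>n<M. Re (a n * cdual_apply (\<phi> n) x)) - Re (cdual_apply \<psi> x)) < e"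
    proof (intro exI allI impI)
      fix M assume M: "N \<le> M"
      let ?T = "\<Sum>n<M. bdd_single n (bddfun_apply (B x) n)"
      have "Re (a n * cdual_apply (\<phi> n) x) = w n * Re (a n * bddfun_apply (B x) n)" for n
        unfolding WB[symmetric] W_def by (simp add: algebra_simps)
      then have "(\<Sum>n<M. Re (a n * cdual_apply (\<phi> n) x)) - Re (cdual_apply \<psi> x) = \<Lambda> (?T - B x)"
        by (simp add: linear_diff[OF L(1)] L_sum LB)
      also have "norm \<dots> \<le> q (?T - B x)" using L_abs by simp
      also have "\<dots> \<le> ellp_norm p (\<lambda>n. if n < N then 0 else W (B x) n)"
        unfolding q_def
      proof (rule ellp_mono(2)[OF p])
        show "(\<lambda>n. if n < N then 0 else W (B x) n) \<in> ellp p"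
          by (rule ellp_mono(1)[OF p W_ellp[of "B x"]]) simp
        show "norm (W (?T - B x) n) \<le> norm (if n < N then 0 else W (B x) n)" for n
          using M by (simp add: W_def bddfun_apply_simps bddfun_apply_sum_single)
      qed
      finally show "norm ((\<Sum>n<M. Re (a n * cdual_apply (\<phi> n) x)) - Re (cdual_apply \<psi> x)) < e"
        using N e by simp
    qed
  qed
  \<comment> \<open>The imaginary part at \<open>x\<close> is the real part at \<open>- \<i> x\<close>.\<close>
  have "(\<lambda>n. a n * cdual_apply (\<phi> n) x) sums cdual_apply \<psi> x" for x
    using Re_sums[of x] Re_sums[of "(- \<i>) *\<^sub>C x"]
    by (simp add: sums_complex_iff cdual_apply_scaleC algebra_simps)
  with ball show thesis by (rule that)
qed

section \<open>From the bidual to the space, for finitely many points\<close>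

text \<open>
  Consider the cone of all pairs \<open>(a, t)\<close> where \<open>a\<close> is the family \<open>\<Sum>n<N. s
  d n * x n\<close>, indexed by \<open>D\<close>, for vectors with \<open>norm (x n) \<le> t * norm (\<phi>
  n)\<close>. If the family \<open>g\<close> were not close to such an \<open>a\<close> with \<open>t\<close>
  near \<open>1\<close>, then a functional on families, that is, a family \<open>y d\<close> of functionals,
  would be at most \<open>t\<close> on the cone and exceed \<open>1\<close> at \<open>g\<close>. For \<open>Y n
  = \<Sum>d. s d n * y d\<close> the first property says that \<open>\<Sum>n. norm (\<phi> n) * norm (Y n) \<le>
  1\<close>. But the value at \<open>g\<close> is the real part of \<open>\<Sum>n. \<phi> n (Y n)\<close>, which
  is then at most \<open>1\<close>.
\<close>

lemma finite_bidual_approximation: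
  fixes \<phi> :: "nat \<Rightarrow> 'f::complex_normed_vector cdual cdual" and g :: "'k \<Rightarrow> 'f"
    and s :: "'k \<Rightarrow> nat \<Rightarrow> complex"
  assumes D: "finite D" and \<theta>: "0 < \<theta>"
    and rep: "\<And>d y. d \<in> D \<Longrightarrow> (\<lambda>n. s d n * cdual_apply (\<phi> n) y) sums cdual_apply y (g d)"
  shows "\<exists>N x. (\<forall>n. norm (x n) \<le> (1 + \<theta>) * norm (\<phi> n)) \<and>
    (\<forall>d\<in>D. norm (g d - (\<Sum>n<N. s d n *\<^sub>C x n)) \<le> \<theta>)"
proof -
  define act :: "nat \<Rightarrow> (nat \<Rightarrow> 'f) \<Rightarrow> ('k, 'f) bddfun"
    where "act N x = (\<Sum>d\<in>D. bdd_single d (\<Sum>n<N. s d n *\<^sub>C x n))" for N x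
  define z :: "('k, 'f) bddfun" where "z = (\<Sum>d\<in>D. bdd_single d (g d))"
  \<comment> \<open>An approximation with total cost less than \<open>1 + \<theta>\<close> then has an error less than \<open>(1 + \<theta>) * \<delta> = \<theta>\<close>.\<close>
  define \<delta> where "\<delta> = \<theta> / (1 + \<theta>)"
  have \<delta>: "0 < \<delta>" using \<theta> by (simp add: \<delta>_def)
  define q where "q u = norm u / \<delta>" for u :: "('k, 'f) bddfun"
  have q: "sublinear q"
    using \<delta> by (simp add: sublinear_def q_def norm_triangle_ineq divide_right_mono
      flip: add_divide_distrib)
  define G where "G = {(act N x, t) | N x t. 0 \<le> t \<and> (\<forall>n. norm (x n) \<le> t * norm (\<phi> n)) \<and> (\<forall>n\<ge>N. x n = 0)}"
  have act_extend: "act N x = act M x" if "N \<le> M" "\<forall>n\<ge>N. x n = 0" for N M x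
    unfolding act_def using that by (intro sum.cong refl arg_cong[where f = "bdd_single _"] sum.mono_neutral_left) auto
  have act_add: "act N (\<lambda>n. x n + x' n) = act N x + act N x'" for N x x'
    by (simp add: act_def scaleC_add_right sum.distrib linear_add[OF linear_bdd_single])
  have act_scale: "act N (\<lambda>n. r *\<^sub>R x n) = r *\<^sub>R act N x" for N r x
  proof -
    have "s d n *\<^sub>C r *\<^sub>R x n = r *\<^sub>R s d n *\<^sub>C x n" for d n
      by (rule linear_scale[OF bounded_linear.linear[OF bounded_linear_scaleC]])
    then show ?thesis
      by (simp add: act_def linear_scale[OF linear_bdd_single] flip: scaleR_sum_right)
  qed
  have G: "convex_cone G"
    unfolding convex_cone_iff
  proof (intro conjI ballI allI impI)
    have "act 0 (\<lambda>_. 0) = 0" using act_scale[of 0 0 "\<lambda>_. 0"] by simp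
    then show "0 \<in> G" unfolding G_def zero_prod_def by force
  next
    fix u u' assume "u \<in> G" "u' \<in> G"
    then obtain N x t N' x' t' where *: "u = (act N x, t)" "u' = (act N' x', t')" "0 \<le> t" "0 \<le> t'"
      "\<forall>n. norm (x n) \<le> t * norm (\<phi> n)" "\<forall>n. norm (x' n) \<le> t' * norm (\<phi> n)"
      "\<forall>n\<ge>N. x n = 0" "\<forall>n\<ge>N'. x' n = 0"
      unfolding G_def by blast
    have "u + u' = (act (max N N') (\<lambda>n. x n + x' n), t + t')"
      using * act_extend[of N "max N N'" x] act_extend[of N' "max N N'" x'] by (simp add: act_add)
    moreover have "norm (x n + x' n) \<le> (t + t') * norm (\<phi> n)" for n
      using *(5,6) by (auto simp: distrib_right intro!: norm_triangle_mono)
    moreover have "\<forall>n\<ge>max N N'. x n + x' n = 0" using * by auto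
    ultimately show "u + u' \<in> G" unfolding G_def using *(3,4) by fastforce
  next
    fix u and c :: real assume "u \<in> G" and c: "0 \<le> c"
    then obtain N x t where *: "u = (act N x, t)" "0 \<le> t"
      "\<forall>n. norm (x n) \<le> t * norm (\<phi> n)" "\<forall>n\<ge>N. x n = 0"
      unfolding G_def by blast
    have "c *\<^sub>R u = (act N (\<lambda>n. c *\<^sub>R x n), c * t)" by (simp add: * act_scale)
    moreover have "norm (c *\<^sub>R x n) \<le> (c * t) * norm (\<phi> n)" for n
      using *(3) c by (simp add: mult.assoc mult_left_mono)
    moreover have "\<forall>n\<ge>N. c *\<^sub>R x n = 0" using * by simp
    ultimately show "c *\<^sub>R u \<in> G" unfolding G_def using *(2) c by fastforce
  qed
  have compat: "0 \<le> q (- a) + t" if "(a, t) \<in> G" for a t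
    using that \<delta> by (auto simp: G_def q_def)
  obtain \<Lambda> where L: "linear \<Lambda>" "\<And>u. \<Lambda> u \<le> q u" "\<And>a t. (a, t) \<in> G \<Longrightarrow> \<Lambda> a \<le> t"
    "\<Lambda> z = cone_inf q G z"
    using hahn_banach_cone[OF q G compat, where ?v0.0 = z] by metis
  have "\<exists>y. \<forall>v. Re (cdual_apply y v) = \<Lambda> (bdd_single d v)" for d
  proof -
    have "linear (\<lambda>v. \<Lambda> (bdd_single d v))"
      using linear_compose[OF linear_bdd_single L(1)] by (simp add: comp_def)
    moreover have "\<Lambda> (bdd_single d v) \<le> (1 / \<delta>) * norm v" for v
      using L(2)[of "bdd_single d v"] norm_bdd_single_le[of d v] \<delta>
      by (simp add: q_def) (meson divide_right_mono less_imp_le order_trans)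
    ultimately show ?thesis by (metis cdual_of_real_functional)
  qed
  then obtain y where y: "\<And>d v. Re (cdual_apply (y d) v) = \<Lambda> (bdd_single d v)" by metis
  define Y where "Y n = (\<Sum>d\<in>D. s d n *\<^sub>C y d)" for n
  have Y_apply: "cdual_apply (Y n) v = (\<Sum>d\<in>D. s d n * cdual_apply (y d) v)" for n v
    unfolding Y_def by (induction D rule: infinite_finite_induct) (simp_all add: cdual_apply_simps)
  have \<phi>Y: "cdual_apply (\<phi> n) (Y n) = (\<Sum>d\<in>D. s d n * cdual_apply (\<phi> n) (y d))" for n
    by (simp add: Y_def linear_sum[OF linear_cdual_apply] cdual_apply_scaleC)
  have L_act: "\<Lambda> (act N x) = (\<Sum>n<N. Re (cdual_apply (Y n) (x n)))" for N x
    by (simp add: act_def linear_sum[OF L(1)] y[symmetric] linear_sum[OF linear_cdual_apply]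
      cdual_apply_scaleC Y_apply sum.swap[of _ D])
  have Y_bound: "(\<Sum>n<N. norm (\<phi> n) * norm (Y n)) \<le> 1" for N
  proof (rule field_le_epsilon)
    fix e :: real assume e: "0 < e"
    define R where "R = (\<Sum>n<N. norm (\<phi> n))"
    have R: "0 \<le> R" by (simp add: R_def sum_nonneg)
    define \<tau> where "\<tau> = e / (R + 1)"
    have \<tau>: "0 < \<tau>" "\<tau> * R \<le> e" using e R by (auto simp: \<tau>_def field_simps)
    have "\<forall>n. \<exists>v. norm v \<le> 1 \<and> norm (Y n) - \<tau> \<le> Re (cdual_apply (Y n) v)"
      using cdual_almost_attains_norm[OF \<tau>(1)] by metis
    then obtain v where v: "\<And>n. norm (v n) \<le> 1" "\<And>n. norm (Y n) - \<tau> \<le> Re (cdual_apply (Y n) (v n))"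
      by metis
    define x where "x n = (if n < N then norm (\<phi> n) *\<^sub>R v n else 0)" for n
    have "(\<Sum>n<N. norm (\<phi> n) * (norm (Y n) - \<tau>)) \<le> (\<Sum>n<N. Re (cdual_apply (Y n) (x n)))"
      by (rule sum_mono)
        (simp add: x_def linear_scale[OF linear_cdual_apply] mult_left_mono v)
    also have "\<dots> = \<Lambda> (act N x)" by (simp add: L_act)
    also have "\<dots> \<le> 1"
      by (rule L(3)) (use v(1) in \<open>force simp: G_def x_def intro!: exI[of _ N] exI[of _ x] mult_left_le\<close>)
    finally have "(\<Sum>n<N. norm (\<phi> n) * norm (Y n)) \<le> 1 + \<tau> * R"
      by (simp add: right_diff_distrib sum_subtractf R_def sum_distrib_left mult.commute)
    with \<tau> show "(\<Sum>n<N. norm (\<phi> n) * norm (Y n)) \<le> 1 + e" by simp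
  qed
  have "(\<lambda>n. \<Sum>d\<in>D. s d n * cdual_apply (\<phi> n) (y d)) sums (\<Sum>d\<in>D. cdual_apply (y d) (g d))"
    by (rule sums_sum) (rule rep)
  then have "(\<lambda>n. Re (cdual_apply (\<phi> n) (Y n))) sums Re (\<Sum>d\<in>D. cdual_apply (y d) (g d))"
    unfolding \<phi>Y by (rule sums_Re)
  moreover have "Re (\<Sum>d\<in>D. cdual_apply (y d) (g d)) = \<Lambda> z"
    by (simp add: z_def linear_sum[OF L(1)] y)
  moreover have "(\<Sum>n<N. Re (cdual_apply (\<phi> n) (Y n))) \<le> 1" for N
  proof -
    have "(\<Sum>n<N. Re (cdual_apply (\<phi> n) (Y n))) \<le> (\<Sum>n<N. norm (\<phi> n) * norm (Y n))"
      by (intro sum_mono) (meson complex_Re_le_cmod norm_cdual_apply_le order_trans)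
    with Y_bound show ?thesis by (meson order_trans)
  qed
  ultimately have "\<Lambda> z \<le> 1"
    unfolding sums_def by (metis (no_types, lifting) LIMSEQ_le_const2)
  then have "cone_inf q G z < 1 + \<theta>" using L(4) \<theta> by simp
  then have "\<exists>(a, t)\<in>G. q (z - a) + t < 1 + \<theta>"
    using cone_inf_greatest[OF q G compat, of "1 + \<theta>" z] by force
  then obtain N x t where x: "norm (z - act N x) / \<delta> + t < 1 + \<theta>" "0 \<le> t"
    "\<And>n. norm (x n) \<le> t * norm (\<phi> n)"
    unfolding G_def q_def by blast
  show ?thesis
  proof (intro exI[of _ N] exI[of _ x] conjI allI ballI)
    have "0 \<le> norm (z - act N x) / \<delta>" using \<delta> by simp
    then have "t \<le> 1 + \<theta>" using x(1) by linarith
    then show "norm (x n) \<le> (1 + \<theta>) * norm (\<phi> n)" for n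
      using x(3)[of n] by (meson mult_right_mono norm_ge_zero order_trans)
    fix d assume d: "d \<in> D"
    have "norm (z - act N x) / \<delta> < 1 + \<theta>" using x(1,2) by linarith
    then have "norm (z - act N x) < (1 + \<theta>) * \<delta>" using \<delta> by (simp add: pos_divide_less_eq)
    also have "(1 + \<theta>) * \<delta> = \<theta>" using \<theta> by (simp add: \<delta>_def)
    finally have "norm (z - act N x) < \<theta>" .
    moreover have "norm (g d - (\<Sum>n<N. s d n *\<^sub>C x n)) \<le> norm (z - act N x)"
      using norm_bddfun_upper[of "z - act N x" d] d
      by (simp add: bddfun_apply_simps z_def act_def bddfun_apply_sum_single[OF D])
    ultimately show "norm (g d - (\<Sum>n<N. s d n *\<^sub>C x n)) \<le> \<theta>" by simp
  qed
qed

section \<open>Domination and finite pieces\<close>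

definition interleave :: "(nat \<Rightarrow> 'a) \<Rightarrow> (nat \<Rightarrow> 'a) \<Rightarrow> nat \<Rightarrow> 'a"
  where "interleave u v n = (if even n then u (n div 2) else v ((n - 1) div 2))"

lemma ellp_interleave:
  fixes u v :: "nat \<Rightarrow> 'a::real_normed_vector"
  assumes p: "1 \<le> p" and u: "u \<in> ellp p" and v: "v \<in> ellp p"
  shows "interleave u v \<in> ellp p"
    and "ellp_norm p (interleave u v) \<le> ellp_norm p u + ellp_norm p v"
    and "ellp_norm p u \<le> ellp_norm p (interleave u v)"
    and "ellp_norm p v \<le> ellp_norm p (interleave u v)"
proof -
  define A B where "A = (\<Sum>n. norm (u n) powr p)" and "B = (\<Sum>n. norm (v n) powr p)"
  have AB: "0 \<le> A" "0 \<le> B"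
    using u v by (auto simp: A_def B_def ellp_def intro!: suminf_nonneg)
  have norms: "ellp_norm p u = A powr (1 / p)" "ellp_norm p v = B powr (1 / p)"
    by (simp_all add: ellp_norm_def A_def B_def)
  have sums: "(\<lambda>n. norm (interleave u v n) powr p) sums (B + A)"
    using sums_if[of "\<lambda>n. norm (v n) powr p" B "\<lambda>n. norm (u n) powr p" A] u v
    by (simp add: interleave_def A_def B_def ellp_def summable_sums if_distrib[of "\<lambda>t. norm t powr p"] cong: if_cong)
  then show "interleave u v \<in> ellp p" by (simp add: ellp_def sums_summable)
  have norm: "ellp_norm p (interleave u v) = (B + A) powr (1 / p)"
    using sums by (simp add: ellp_norm_def sums_unique[symmetric])
  show "ellp_norm p u \<le> ellp_norm p (interleave u v)"
    "ellp_norm p v \<le> ellp_norm p (interleave u v)"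
    unfolding norm norms using p AB by (auto intro!: powr_mono2)
  have "A + B \<le> (A powr (1 / p) + B powr (1 / p)) powr p"
    using sum_powr_le_powr_sum[OF p, of UNIV "\<lambda>b. if b then A powr (1 / p) else B powr (1 / p)"] p AB
    by (simp add: UNIV_bool powr_powr add.commute)
  then have "(B + A) powr (1 / p) \<le> ((A powr (1 / p) + B powr (1 / p)) powr p) powr (1 / p)"
    using p AB by (intro powr_mono2) auto
  then show "ellp_norm p (interleave u v) \<le> ellp_norm p u + ellp_norm p v"
    unfolding norm norms using p by (simp add: powr_powr)
qed

text \<open>
  The condition that defines quasi p-nuclearity of the transpose, for an arbitrary family of vectors \<open>g
  k\<close> in place of the values of \<open>f\<close> and with a bound \<open>M\<close> for the norm of the
  dominating sequence.
\<close>

definition p_dominated :: "real \<Rightarrow> 'k set \<Rightarrow> real \<Rightarrow> ('k \<Rightarrow> 'f::complex_normed_vector) \<Rightarrow> bool"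
  where "p_dominated p K M g \<longleftrightarrow> (\<exists>\<phi>\<in>ellp p. ellp_norm p \<phi> \<le> M \<and>
    (\<forall>k\<in>K. \<forall>y. norm (cdual_apply y (g k)) \<le> ellp_norm p (\<lambda>n. cdual_apply (\<phi> n) y)))"

lemma p_dominated_norm_le:
  assumes p: "1 \<le> p" and g: "p_dominated p K M g" and k: "k \<in> K"
  shows "norm (g k) \<le> M"
proof -
  obtain \<phi> where \<phi>: "\<phi> \<in> ellp p" "ellp_norm p \<phi> \<le> M"
    "\<And>y. norm (cdual_apply y (g k)) \<le> ellp_norm p (\<lambda>n. cdual_apply (\<phi> n) y)"
    using g k unfolding p_dominated_def by blast
  show ?thesis
  proof (rule norm_le_dual)
    show "0 \<le> M" using \<phi>(2) ellp_norm_nonneg[of p \<phi>] by linarith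
    fix y
    have "norm (cdual_apply y (g k)) \<le> norm y * ellp_norm p \<phi>"
      using \<phi>(3)[of y] cdual_ellp(2)[OF p \<phi>(1), of y] by linarith
    also have "\<dots> \<le> M * norm y"
      using mult_right_mono[OF \<phi>(2) norm_ge_zero[of y]] by (simp add: mult.commute)
    finally show "norm (cdual_apply y (g k)) \<le> M * norm y" .
  qed
qed

text \<open>
  Interleave the two sequences; the factor \<open>2\<close> covers replacing a sum of two p-norms by twice the
  larger one. It does no harm because only remainders of small norm are treated this way.
\<close>

lemma p_dominated_by_two:
  fixes \<phi> \<psi> :: "nat \<Rightarrow> 'f::complex_normed_vector cdual cdual"
  assumes p: "1 \<le> p" and \<phi>: "\<phi> \<in> ellp p" and \<psi>: "\<psi> \<in> ellp p"
    and dom: "\<And>k y. k \<in> K \<Longrightarrow> norm (cdual_apply y (g k)) \<le>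
      ellp_norm p (\<lambda>n. cdual_apply (\<phi> n) y) + ellp_norm p (\<lambda>n. cdual_apply (\<psi> n) y)"
  shows "p_dominated p K (2 * (ellp_norm p \<phi> + ellp_norm p \<psi>)) g"
proof -
  define \<omega> where "\<omega> n = 2 *\<^sub>R interleave \<phi> \<psi> n" for n
  note I = ellp_interleave[OF p \<phi> \<psi>]
  have "\<omega> \<in> ellp p" "ellp_norm p \<omega> \<le> 2 * ellp_norm p (interleave \<phi> \<psi>)"
    unfolding \<omega>_def by (auto intro: ellp_dominated[OF p I(1), of 2])
  moreover have "norm (cdual_apply y (g k)) \<le> ellp_norm p (\<lambda>n. cdual_apply (\<omega> n) y)"
    if "k \<in> K" for k y
  proof -
    let ?u = "\<lambda>n. cdual_apply (\<phi> n) y" and ?v = "\<lambda>n. cdual_apply (\<psi> n) y"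
    have uv: "?u \<in> ellp p" "?v \<in> ellp p" by (intro cdual_ellp p \<phi> \<psi>)+
    have "(\<lambda>n. cdual_apply (\<omega> n) y) = (\<lambda>n. 2 *\<^sub>R interleave ?u ?v n)"
      by (simp add: \<omega>_def interleave_def cdual_apply_simps fun_eq_iff)
    then have "ellp_norm p (\<lambda>n. cdual_apply (\<omega> n) y) = 2 * ellp_norm p (interleave ?u ?v)"
      using ellp_norm_scaleR[OF p ellp_interleave(1)[OF p uv], of 2] by simp
    then show ?thesis
      using dom[OF that, of y] ellp_interleave(3,4)[OF p uv] by linarith
  qed
  moreover have "2 * ellp_norm p (interleave \<phi> \<psi>) \<le> 2 * (ellp_norm p \<phi> + ellp_norm p \<psi>)"
    using I(2) by simp
  ultimately show ?thesis unfolding p_dominated_def by (meson order_trans)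
qed

text \<open>
  The family \<open>h\<close> is represented by one finite sequence \<open>x\<close> in the space itself. That
  the coefficients vanish from \<open>N\<close> on is what later makes the coefficients of infinitely many
  pieces tend to zero, as is required in the case \<open>p = 1\<close>.
\<close>

definition finite_piece :: "real \<Rightarrow> 'k set \<Rightarrow> real \<Rightarrow> ('k \<Rightarrow> 'f::complex_normed_vector) \<Rightarrow> bool"
  where "finite_piece p K M h \<longleftrightarrow> (\<exists>(N::nat) x s. lp_sum p {..<N} x \<le> M \<and>
    (\<forall>k\<in>K. s k \<in> dual_ball p \<and> (\<forall>n\<ge>N. s k n = 0) \<and> h k = (\<Sum>n<N. s k n *\<^sub>C x n)))"

text \<open>
  The first \<open>N\<close> coordinates lie in a compact disc. Rounding them to a finite net gives finitely
  many codes, and \<open>r\<close> picks one element of \<open>K\<close> for each code.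
\<close>

lemma finite_coordinate_net:
  fixes s :: "'k \<Rightarrow> nat \<Rightarrow> complex"
  assumes bound: "\<And>k n. k \<in> K \<Longrightarrow> norm (s k n) \<le> 1" and \<delta>: "0 < \<delta>"
  obtains r where "finite (r ` K)" "r ` K \<subseteq> K"
    "\<And>k n. k \<in> K \<Longrightarrow> n < N \<Longrightarrow> norm (s k n - s (r k) n) \<le> \<delta>"
proof -
  have "compact (cball (0::complex) 1)" by simp
  then obtain Z where Z: "finite Z" "cball (0::complex) 1 \<subseteq> (\<Union>z\<in>Z. ball z (\<delta> / 2))"
    using \<delta> unfolding compact_eq_totally_bounded by (metis half_gt_zero)
  define near where "near c = (SOME z. z \<in> Z \<and> dist z c < \<delta> / 2)" for c
  have near: "near c \<in> Z \<and> dist (near c) c < \<delta> / 2" if "norm c \<le> 1" for c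
    unfolding near_def by (rule someI_ex) (use Z(2) that in \<open>force simp: mem_ball\<close>)
  define code where "code k = restrict (\<lambda>n. near (s k n)) {..<N}" for k
  define r where "r k = (SOME k'. k' \<in> K \<and> code k' = code k)" for k
  have r: "r k \<in> K \<and> code (r k) = code k" if "k \<in> K" for k
    unfolding r_def by (rule someI[of _ k]) (use that in simp)
  have "code ` K \<subseteq> {..<N} \<rightarrow>\<^sub>E Z"
    unfolding code_def image_subset_iff restrict_PiE_iff using near bound by blast
  then have "finite (code ` K)"
    by (rule finite_subset) (simp add: finite_PiE Z(1))
  moreover have "r ` K = (\<lambda>c. SOME k'. k' \<in> K \<and> code k' = c) ` (code ` K)"
    by (simp add: r_def image_image)
  ultimately have "finite (r ` K)" by simp
  moreover have "norm (s k n - s (r k) n) \<le> \<delta>" if "k \<in> K" "n < N" for k n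
  proof -
    have "near (s (r k) n) = near (s k n)"
      using r[OF that(1)] that(2) unfolding code_def by (metis lessThan_iff restrict_apply')
    then show ?thesis
      using near[OF bound[OF that(1)], of n] near[OF bound, of "r k" n] r[OF that(1)]
        dist_triangle2[of "s k n" "s (r k) n" "near (s k n)"]
      by (simp add: dist_norm norm_minus_commute)
  qed
  ultimately show thesis using r by (intro that[of r]) auto
qed

text \<open>
  Let \<open>s k\<close> be coefficients that represent \<open>g k\<close> by \<open>\<phi>\<close>. Choose a
  large \<open>N\<close>, a map \<open>r\<close> of \<open>K\<close> to a finite subset that moves the first
  \<open>N\<close> coefficients by very little, and vectors \<open>x n\<close> that represent \<open>g\<close>
  on this subset up to a small error \<open>e\<close>. The piece is \<open>h k = \<Sum>n<L. s (r k) n * x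
  n\<close>. Then \<open>g k - h k = (g k - g (r k)) + e (r k)\<close>, where the first term is small since both
  the first coefficients of \<open>s k - s (r k)\<close> and the tail of \<open>\<phi>\<close> are, and the
  second takes only finitely many small values.
\<close>

lemma split_off_finite_piece:
  fixes g :: "'k \<Rightarrow> 'f::complex_normed_vector"
  assumes p: "1 \<le> p" and g: "p_dominated p K M g" and \<epsilon>: "0 < \<epsilon>"
  obtains h where "finite_piece p K (M + \<epsilon>) h" "p_dominated p K \<epsilon> (\<lambda>k. g k - h k)"
proof -
  obtain \<phi> where \<phi>: "\<phi> \<in> ellp p" "ellp_norm p \<phi> \<le> M"
    and dom: "\<And>k y. k \<in> K \<Longrightarrow> norm (cdual_apply y (g k)) \<le> ellp_norm p (\<lambda>n. cdual_apply (\<phi> n) y)"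
    using g unfolding p_dominated_def by blast
  have "\<forall>k\<in>K. \<exists>a. a \<in> dual_ball p \<and>
      (\<forall>y. (\<lambda>n. a n * cdual_apply (\<phi> n) y) sums cdual_apply y (g k))"
  proof
    fix k assume "k \<in> K"
    then have "norm (cdual_apply (evaluation (g k)) y) \<le> ellp_norm p (\<lambda>n. cdual_apply (\<phi> n) y)" for y
      using dom by simp
    from dominated_functional_representation[OF p \<phi>(1) this]
    obtain a where "a \<in> dual_ball p"
      "\<And>y. (\<lambda>n. a n * cdual_apply (\<phi> n) y) sums cdual_apply (evaluation (g k)) y"
      by blast
    then show "\<exists>a. a \<in> dual_ball p \<and>
        (\<forall>y. (\<lambda>n. a n * cdual_apply (\<phi> n) y) sums cdual_apply y (g k))"
      by auto
  qed
  then obtain s where s: "\<And>k. k \<in> K \<Longrightarrow> s k \<in> dual_ball p"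
    "\<And>k y. k \<in> K \<Longrightarrow> (\<lambda>n. s k n * cdual_apply (\<phi> n) y) sums cdual_apply y (g k)"
    by (auto dest!: bchoice)
  define F where "F = ellp_norm p \<phi>"
  have F: "0 \<le> F" "F \<le> M" using \<phi>(2) by (simp_all add: F_def ellp_norm_nonneg)
  obtain N where N: "ellp_norm p (\<lambda>n. if n < N then 0 else \<phi> n) \<le> \<epsilon> / 32"
    using ellp_tail_small[OF p \<phi>(1), of "\<epsilon> / 32"] \<epsilon> by auto
  define \<delta> where "\<delta> = \<epsilon> / (16 * (N * F + 1))"
  have NF: "0 < N * F + 1" using F by (simp add: add_nonneg_pos)
  then have \<delta>: "0 < \<delta>" using \<epsilon> by (simp add: \<delta>_def)
  obtain r where r: "finite (r ` K)" "r ` K \<subseteq> K"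
    "\<And>k n. k \<in> K \<Longrightarrow> n < N \<Longrightarrow> norm (s k n - s (r k) n) \<le> \<delta>"
    using finite_coordinate_net[of K s \<delta> N] dual_ball_norm_le[OF s(1) p] \<delta> by blast
  define m where "m = card (r ` K)"
  define \<theta> where "\<theta> = min (\<epsilon> / (4 * (real m + 1))) (\<epsilon> / (F + 1))"
  have \<theta>: "0 < \<theta>" using \<epsilon> F by (simp add: \<theta>_def)
  have m\<theta>: "real m * \<theta> \<le> \<epsilon> / 4"
  proof -
    have "real m * \<theta> \<le> (real m + 1) * (\<epsilon> / (4 * (real m + 1)))"
      using \<theta> by (intro mult_mono) (auto simp: \<theta>_def)
    also have "\<dots> = \<epsilon> / 4" by (simp add: field_simps)
    finally show ?thesis .
  qed
  have F\<theta>: "\<theta> * F \<le> \<epsilon>"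
  proof -
    have "\<theta> * F \<le> \<epsilon> / (F + 1) * (F + 1)"
      using \<epsilon> F by (intro mult_mono) (auto simp: \<theta>_def)
    then show ?thesis using F by simp
  qed
  have "(\<lambda>n. s d n * cdual_apply (\<phi> n) y) sums cdual_apply y (g d)" if "d \<in> r ` K" for d y
    using s(2) r(2) that by blast
  then have "\<exists>L x. (\<forall>n. norm (x n) \<le> (1 + \<theta>) * norm (\<phi> n)) \<and>
      (\<forall>d\<in>r ` K. norm (g d - (\<Sum>n<L. s d n *\<^sub>C x n)) \<le> \<theta>)"
    by (rule finite_bidual_approximation[OF r(1) \<theta>])
  then obtain L x where x: "\<And>n. norm (x n) \<le> (1 + \<theta>) * norm (\<phi> n)"
    and approx: "\<And>d. d \<in> r ` K \<Longrightarrow> norm (g d - (\<Sum>n<L. s d n *\<^sub>C x n)) \<le> \<theta>"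
    by blast
  define h where "h k = (\<Sum>n<L. s (r k) n *\<^sub>C x n)" for k
  define e where "e d = g d - (\<Sum>n<L. s d n *\<^sub>C x n)" for d
  have "finite_piece p K (M + \<epsilon>) h"
    unfolding finite_piece_def
  proof (intro exI[of _ L] exI[of _ x] exI[of _ "\<lambda>k n. if n < L then s (r k) n else 0"] conjI ballI)
    have "lp_sum p {..<L} x \<le> ellp_norm p x"
      using x \<theta> by (intro lp_sum_le_ellp_norm ellp_dominated(1)[OF p \<phi>(1), of "1 + \<theta>"] p) auto
    also have "\<dots> \<le> (1 + \<theta>) * F"
      unfolding F_def using x \<theta> by (intro ellp_dominated(2) p \<phi>) auto
    finally show "lp_sum p {..<L} x \<le> M + \<epsilon>" using F F\<theta> by (simp add: distrib_right)
    fix k assume k: "k \<in> K"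
    then have "s (r k) \<in> dual_ball p" using r(2) s(1) by blast
    then show "(\<lambda>n. if n < L then s (r k) n else 0) \<in> dual_ball p"
      by (rule dual_ball_mono) simp
  qed (simp_all add: h_def)
  moreover have "p_dominated p K \<epsilon> (\<lambda>k. g k - h k)"
  proof -
    \<comment> \<open>The factor on the first \<open>N\<close> indices compensates for summing \<open>N\<close> terms, each at most \<open>\<delta> * norm (\<phi> n y)\<close>;
      the factor \<open>4\<close> on the others covers the two coefficient sequences \<open>s k\<close> and \<open>s (r k)\<close>. Each of the two
      parts of the sum is then at most half the p-norm of \<open>\<psi> n y\<close>.\<close>
    define \<psi> where "\<psi> n = (if n < N then 2 * \<delta> * N else 4) *\<^sub>R \<phi> n" for n
    have \<psi>: "\<psi> \<in> ellp p" "ellp_norm p \<psi> \<le> \<epsilon> / 4"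
    proof -
      let ?a = "\<lambda>n. (2 * \<delta> * N) *\<^sub>R \<phi> n" and ?b = "\<lambda>n. 4 *\<^sub>R (if n < N then 0 else \<phi> n)"
      have a: "?a \<in> ellp p" "ellp_norm p ?a \<le> 2 * \<delta> * N * F"
        using \<delta> ellp_dominated[OF p \<phi>(1), of "2 * \<delta> * N" ?a] by (auto simp: F_def abs_mult)
      have t: "(\<lambda>n. if n < N then 0 else \<phi> n) \<in> ellp p"
        by (rule ellp_mono(1)[OF p \<phi>(1)]) simp
      have b: "?b \<in> ellp p" "ellp_norm p ?b \<le> 4 * (\<epsilon> / 32)"
        using ellp_dominated(1)[OF p t, of 4 ?b] ellp_norm_scaleR[OF p t, of 4] N by auto
      have le: "norm (\<psi> n) \<le> norm (norm (?a n) + norm (?b n))" for n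
        using \<delta> by (simp add: \<psi>_def)
      have na: "(\<lambda>n. norm (?a n)) \<in> ellp p" "(\<lambda>n. norm (?b n)) \<in> ellp p"
        using a(1) b(1) by (simp_all add: ellp_def)
      have nn: "ellp_norm p (\<lambda>n. norm (?a n)) = ellp_norm p ?a"
        "ellp_norm p (\<lambda>n. norm (?b n)) = ellp_norm p ?b"
        by (simp_all add: ellp_norm_def)
      show "\<psi> \<in> ellp p"
        by (rule ellp_mono(1)[OF p ellp_add(1)[OF p na] le])
      have "ellp_norm p \<psi> \<le> ellp_norm p ?a + ellp_norm p ?b"
        using ellp_mono(2)[OF p ellp_add(1)[OF p na] le] ellp_add(2)[OF p na] unfolding nn by linarith
      moreover have "2 * \<delta> * N * F \<le> \<epsilon> / 8"
      proof -
        have "2 * \<delta> * N * F = (\<epsilon> / 8) * (N * F / (N * F + 1))"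
          using NF by (simp add: \<delta>_def field_simps)
        also have "\<dots> \<le> \<epsilon> / 8 * 1"
          using NF \<epsilon> F by (intro mult_left_mono) auto
        finally show ?thesis by simp
      qed
      ultimately show "ellp_norm p \<psi> \<le> \<epsilon> / 4" using a(2) b(2) by simp
    qed
    obtain d where d: "bij_betw d {0..<m} (r ` K)"
      using ex_bij_betw_nat_finite[OF r(1)] unfolding m_def by blast
    \<comment> \<open>One entry for each of the finitely many values of \<open>e\<close>.\<close>
    define \<eta> where "\<eta> n = (if n < m then evaluation (e (d n)) else 0)" for n
    have \<eta>: "\<eta> \<in> ellp p" "ellp_norm p \<eta> \<le> \<epsilon> / 4"
    proof -
      have "\<eta> n = 0" if "n \<notin> {..<m}" for n using that by (simp add: \<eta>_def)
      note fs = ellp_norm_finite_support[OF p finite_lessThan this]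
      have "lp_sum p {..<m} \<eta> \<le> (\<Sum>n<m. norm (\<eta> n))"
        by (rule lp_sum_le_sum[OF p]) simp
      also have "\<dots> \<le> (\<Sum>n<m. \<theta>)"
      proof (rule sum_mono)
        fix n assume n: "n \<in> {..<m}"
        then have "d n \<in> r ` K" using bij_betwE[OF d] by auto
        then show "norm (\<eta> n) \<le> \<theta>"
          using n norm_evaluation_le[of "e (d n)"] approx[of "d n"] by (simp add: \<eta>_def e_def)
      qed
      finally show "\<eta> \<in> ellp p" "ellp_norm p \<eta> \<le> \<epsilon> / 4" using fs m\<theta> by auto
    qed
    have "p_dominated p K (2 * (ellp_norm p \<psi> + ellp_norm p \<eta>)) (\<lambda>k. g k - h k)"
    proof (rule p_dominated_by_two[OF p \<psi>(1) \<eta>(1)])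
      fix k y assume k: "k \<in> K"
      then have rk: "r k \<in> K" using r(2) by blast
      define V where "V = ellp_norm p (\<lambda>n. cdual_apply (\<psi> n) y)"
      have v: "(\<lambda>n. cdual_apply (\<psi> n) y) \<in> ellp p" by (rule cdual_ellp(1)[OF p \<psi>(1)])
      have V: "0 \<le> V" by (simp add: V_def ellp_norm_nonneg)
      let ?t = "\<lambda>n. (s k n - s (r k) n) * cdual_apply (\<phi> n) y"
      have term_le: "norm (?t n) \<le> (if n < N then V / (2 * N) else 0)
          + (norm (s k n) * norm (cdual_apply (\<psi> n) y) + norm (s (r k) n) * norm (cdual_apply (\<psi> n) y)) / 4" for n
      proof (cases "n < N")
        case True
        have "norm (?t n) \<le> \<delta> * norm (cdual_apply (\<phi> n) y)"
          using r(3)[OF k True] by (simp add: norm_mult mult_right_mono)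
        also have "\<dots> = norm (cdual_apply (\<psi> n) y) / (2 * N)"
          using True \<delta> by (simp add: \<psi>_def cdual_apply_simps abs_mult)
        also have "\<dots> \<le> V / (2 * N)"
          unfolding V_def by (intro divide_right_mono norm_le_ellp_norm[OF p v]) simp
        finally show ?thesis using True by (simp add: add_increasing2)
      next
        case False
        have "norm (?t n) \<le> (norm (s k n) + norm (s (r k) n)) * norm (cdual_apply (\<phi> n) y)"
          by (simp add: norm_mult mult_right_mono norm_triangle_ineq4)
        also have "norm (cdual_apply (\<phi> n) y) = norm (cdual_apply (\<psi> n) y) / 4"
          using False by (simp add: \<psi>_def cdual_apply_simps)
        finally show ?thesis using False by (simp add: distrib_right add_divide_distrib)
      qed
      have partial: "norm (\<Sum>n<M'. ?t n) \<le> V" for M'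
      proof -
        have ball: "(\<Sum>n<M'. norm (s j n) * norm (cdual_apply (\<psi> n) y)) \<le> V" if "j \<in> K" for j
          using dual_ballD[OF s(1)[OF that], of "{..<M'}" "\<lambda>n. cdual_apply (\<psi> n) y"]
            lp_sum_le_ellp_norm[OF p v, of "{..<M'}"] by (simp add: V_def)
        have "(\<Sum>n<M'. if n < N then V / (2 * N) else 0) \<le> (\<Sum>n<N. V / (2 * N))"
        proof -
          have "(\<Sum>n<M'. if n < N then V / (2 * N) else 0) = (\<Sum>n\<in>{n\<in>{..<M'}. n < N}. V / (2 * N))"
            by (rule sum.inter_filter[symmetric]) simp
          also have "\<dots> \<le> (\<Sum>n<N. V / (2 * N))" using V by (intro sum_mono2) auto
          finally show ?thesis .
        qed
        also have "\<dots> \<le> V / 2" using V by simp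
        finally have head: "(\<Sum>n<M'. if n < N then V / (2 * N) else 0) \<le> V / 2" .
        have "norm (\<Sum>n<M'. ?t n) \<le> (\<Sum>n<M'. (if n < N then V / (2 * N) else 0)
          + (norm (s k n) * norm (cdual_apply (\<psi> n) y) + norm (s (r k) n) * norm (cdual_apply (\<psi> n) y)) / 4)"
          using term_le by (intro order_trans[OF norm_sum] sum_mono)
        also have "\<dots> = (\<Sum>n<M'. if n < N then V / (2 * N) else 0)
          + ((\<Sum>n<M'. norm (s k n) * norm (cdual_apply (\<psi> n) y))
            + (\<Sum>n<M'. norm (s (r k) n) * norm (cdual_apply (\<psi> n) y))) / 4"
          by (simp only: sum.distrib flip: sum_divide_distrib)
        also have "\<dots> \<le> V"
        proof -
          have "a + (b + c) / 4 \<le> V" if "a \<le> V / 2" "b \<le> V" "c \<le> V" for a b c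
            using that by (simp add: field_simps)
          from this[OF head ball[OF k] ball[OF rk]] show ?thesis .
        qed
        finally show ?thesis .
      qed
      have "?t sums cdual_apply y (g k - g (r k))"
        using sums_diff[OF s(2)[OF k, of y] s(2)[OF rk, of y]]
        by (simp add: linear_diff[OF linear_cdual_apply] left_diff_distrib)
      then have "(\<lambda>M'. norm (\<Sum>n<M'. ?t n)) \<longlonglongrightarrow> norm (cdual_apply y (g k - g (r k)))"
        unfolding sums_def by (rule tendsto_norm)
      then have 1: "norm (cdual_apply y (g k - g (r k))) \<le> V"
        by (rule LIMSEQ_le_const2) (use partial in blast)
      obtain j where j: "j < m" "d j = r k"
        using d k unfolding bij_betw_def by (metis atLeastLessThan_iff imageE imageI)
      have 2: "norm (cdual_apply y (e (r k))) \<le> ellp_norm p (\<lambda>n. cdual_apply (\<eta> n) y)"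
        using norm_le_ellp_norm[OF p cdual_ellp(1)[OF p \<eta>(1), of y], of j] j by (simp add: \<eta>_def)
      have split: "g k - h k = (g k - g (r k)) + e (r k)" by (simp add: h_def e_def)
      show "norm (cdual_apply y (g k - h k)) \<le>
          ellp_norm p (\<lambda>n. cdual_apply (\<psi> n) y) + ellp_norm p (\<lambda>n. cdual_apply (\<eta> n) y)"
        unfolding split linear_add[OF linear_cdual_apply] V_def[symmetric]
        by (rule norm_triangle_mono[OF 1 2])
    qed
    moreover have "2 * (ellp_norm p \<psi> + ellp_norm p \<eta>) \<le> \<epsilon>" using \<psi>(2) \<eta>(2) by simp
    ultimately show ?thesis unfolding p_dominated_def by (meson order_trans)
  qed
  ultimately show thesis by (rule that)
qed

section \<open>Summing up the pieces\<close>

lemma finite_pairs_rectangle: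
  assumes "finite (S :: (nat \<times> nat) set)"
  obtains L where "S \<subseteq> {..<L} \<times> {..<L}"
proof -
  have "finite (fst ` S \<union> snd ` S)" using assms by simp
  then obtain L where "fst ` S \<union> snd ` S \<subseteq> {..<L}"
    using finite_nat_bounded by blast
  then have "S \<subseteq> {..<L} \<times> {..<L}" by force
  then show thesis by (rule that)
qed

lemma lp_sum_reindex:
  assumes "inj_on f S"
  shows "lp_sum p (f ` S) x = lp_sum p S (x \<circ> f)"
  using assms by (simp add: lp_sum_def sum.reindex)

lemma dual_ball_reindex:
  fixes f :: "'j \<Rightarrow> 'i"
  assumes a: "a \<in> dual_ball p" and f: "inj f"
  shows "a \<circ> f \<in> dual_ball p"
  unfolding dual_ball_def
proof (intro CollectI allI impI)
  fix S :: "'j set" and v :: "'j \<Rightarrow> real"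
  assume S: "finite S" and v: "\<forall>i. 0 \<le> v i"
  have inj: "inj_on f S" using f by (rule inj_on_subset) simp
  let ?w = "\<lambda>j. v (inv f j)"
  have "(\<Sum>i\<in>S. norm ((a \<circ> f) i) * v i) = (\<Sum>j\<in>f ` S. norm (a j) * norm (?w j))"
    using f v by (simp add: sum.reindex[OF inj])
  also have "\<dots> \<le> lp_sum p (f ` S) ?w"
    using S by (intro dual_ballD[OF a]) simp
  also have "\<dots> = lp_sum p S v"
    using f by (simp add: lp_sum_reindex[OF inj] comp_def)
  finally show "(\<Sum>i\<in>S. norm ((a \<circ> f) i) * v i) \<le> lp_sum p S v" .
qed

text \<open>
  Each slice of a finite set of pairs contributes at most \<open>\<mu> l\<close> times the p-norm over the whole
  set.
\<close>

lemma dual_ball_convex_concatenation: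
  fixes a :: "nat \<Rightarrow> nat \<Rightarrow> complex"
  assumes p: "1 \<le> p" and a: "\<And>l. a l \<in> dual_ball p"
    and \<mu>: "\<And>l. 0 \<le> \<mu> l" "\<And>L. (\<Sum>l<L. \<mu> l) \<le> 1"
  shows "(\<lambda>(l, n). of_real (\<mu> l) * a l n) \<in> dual_ball p"
  unfolding dual_ball_def
proof (intro CollectI allI impI)
  fix S :: "(nat \<times> nat) set" and v :: "nat \<times> nat \<Rightarrow> real"
  assume S: "finite S" and v: "\<forall>i. 0 \<le> v i"
  obtain L where L: "S \<subseteq> {..<L} \<times> {..<L}" by (rule finite_pairs_rectangle[OF S])
  define slice where "slice l = {n. (l, n) \<in> S}" for l
  have slice: "finite (slice l)" for l
    using finite_subset[of "slice l" "snd ` S"] S by (force simp: slice_def)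
  have S_eq: "S = Sigma {..<L} slice" using L by (auto simp: slice_def)
  have "(\<Sum>i\<in>S. norm (case i of (l, n) \<Rightarrow> of_real (\<mu> l) * a l n) * v i)
      = (\<Sum>(l, n)\<in>Sigma {..<L} slice. \<mu> l * (norm (a l n) * v (l, n)))"
    unfolding S_eq by (rule sum.cong) (auto simp: norm_mult \<mu>(1))
  also have "\<dots> = (\<Sum>l<L. \<mu> l * (\<Sum>n\<in>slice l. norm (a l n) * norm (v (l, n))))"
    using v by (simp add: sum.Sigma[symmetric] slice sum_distrib_left)
  also have "\<dots> \<le> (\<Sum>l<L. \<mu> l * lp_sum p S v)"
  proof (intro sum_mono mult_left_mono \<mu>(1))
    fix l
    have "(\<Sum>n\<in>slice l. norm (a l n) * norm (v (l, n))) \<le> lp_sum p (slice l) (v \<circ> Pair l)"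
      using dual_ballD[OF a slice, where x = "v \<circ> Pair l"] by simp
    also have "\<dots> = lp_sum p (Pair l ` slice l) v"
      by (rule lp_sum_reindex[symmetric]) (simp add: inj_on_def)
    also have "\<dots> \<le> lp_sum p S v"
      using S by (intro lp_sum_mono_set p) (auto simp: slice_def)
    finally show "(\<Sum>n\<in>slice l. norm (a l n) * norm (v (l, n))) \<le> lp_sum p S v" .
  qed
  also have "\<dots> = (\<Sum>l<L. \<mu> l) * lp_sum p S v" by (simp add: sum_distrib_right)
  also have "\<dots> \<le> lp_sum p S v"
    using \<mu> by (intro mult_left_le_one_le) (auto simp: lp_sum_nonneg sum_nonneg)
  finally show "(\<Sum>i\<in>S. norm (case i of (l, n) \<Rightarrow> of_real (\<mu> l) * a l n) * v i) \<le> lp_sum p S v" .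
qed

lemma lp_sum_concatenation_le:
  fixes x :: "nat \<Rightarrow> nat \<Rightarrow> 'f::real_normed_vector"
  assumes p: "1 \<le> p" and x: "\<And>l S. finite S \<Longrightarrow> lp_sum p S (x l) \<le> C l"
    and C: "\<And>L. (\<Sum>l<L. C l) \<le> R" and S: "finite S"
  shows "lp_sum p S (\<lambda>(l, n). x l n) \<le> R"
proof -
  obtain L where L: "S \<subseteq> {..<L} \<times> {..<L}" by (rule finite_pairs_rectangle[OF S])
  have C0: "0 \<le> C l" for l using x[of "{}" l] by (simp add: lp_sum_def)
  then have nonneg: "0 \<le> (\<Sum>l<L. C l)" by (simp add: sum_nonneg)
  have "(\<Sum>i\<in>{..<L} \<times> {..<L}. norm (case i of (l, n) \<Rightarrow> x l n) powr p)
      = (\<Sum>l<L. \<Sum>n<L. norm (x l n) powr p)"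
    by (simp add: sum.cartesian_product case_prod_unfold)
  also have "\<dots> \<le> (\<Sum>l<L. C l powr p)"
    by (rule sum_mono) (rule lp_sum_le_iff[OF p C0, THEN iffD1], rule x, simp)
  also have "\<dots> \<le> (\<Sum>l<L. C l) powr p"
    using C0 by (intro sum_powr_le_powr_sum[OF p]) auto
  finally have "lp_sum p ({..<L} \<times> {..<L}) (\<lambda>(l, n). x l n) \<le> (\<Sum>l<L. C l)"
    using nonneg by (subst lp_sum_le_iff[OF p]) auto
  then show ?thesis
    using lp_sum_mono_set[OF p _ L, of "\<lambda>(l, n). x l n"] C[of L] by simp
qed

text \<open>
  Scale the coefficients of the piece \<open>l\<close> by \<open>\<mu> l\<close> and its vectors by \<open>1 /
  \<mu> l\<close>. As the weights have sum at most \<open>1\<close>, the concatenated coefficients stay in the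
  dual ball. They tend to zero because the weights do and each piece is finite.
\<close>

lemma concatenate_finite_pieces:
  fixes g :: "'k \<Rightarrow> 'f::complex_banach" and h :: "nat \<Rightarrow> 'k \<Rightarrow> 'f"
  assumes p: "1 \<le> p" and piece: "\<And>l. finite_piece p K (M l) (h l)"
    and \<mu>: "\<And>l. 0 < \<mu> l" "\<And>L. (\<Sum>l<L. \<mu> l) \<le> 1"
    and R: "\<And>L. (\<Sum>l<L. M l / \<mu> l) \<le> R"
    and sum: "\<And>k. k \<in> K \<Longrightarrow> (\<lambda>l. h l k) sums g k"
  shows "\<exists>x\<in>ellp p. ellp_norm p x \<le> R \<and> g ` K \<subseteq> p_conv p x"
proof -
  have "\<forall>l. finite_piece p K (M l) (h l)" using piece by blast
  then have "\<exists>(N :: nat \<Rightarrow> nat) x s. \<forall>l. lp_sum p {..<N l} (x l) \<le> M l \<and>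
    (\<forall>k\<in>K. s l k \<in> dual_ball p \<and> (\<forall>n\<ge>N l. s l k n = 0) \<and> h l k = (\<Sum>n<N l. s l k n *\<^sub>C x l n))"
    unfolding finite_piece_def choice_iff .
  then obtain N :: "nat \<Rightarrow> nat" and x :: "nat \<Rightarrow> nat \<Rightarrow> 'f" and s :: "nat \<Rightarrow> 'k \<Rightarrow> nat \<Rightarrow> complex"
    where x: "\<And>l. lp_sum p {..<N l} (x l) \<le> M l"
    and s: "\<And>l k. k \<in> K \<Longrightarrow> s l k \<in> dual_ball p" "\<And>l k n. k \<in> K \<Longrightarrow> N l \<le> n \<Longrightarrow> s l k n = 0"
    and h: "\<And>l k. k \<in> K \<Longrightarrow> h l k = (\<Sum>n<N l. s l k n *\<^sub>C x l n)"
    by blast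
  define X where "X l n = (if n < N l then inverse (\<mu> l) *\<^sub>R x l n else 0)" for l n
  define Y where "Y m = (\<lambda>(l, n). X l n) (prod_decode m)" for m
  have X_sum: "lp_sum p S (X l) \<le> M l / \<mu> l" if S: "finite S" for l S
  proof -
    have "lp_sum p S (X l) \<le> lp_sum p (S \<union> {..<N l}) (X l)"
      using S by (intro lp_sum_mono_set p) auto
    also have "\<dots> = lp_sum p {..<N l} (X l)"
      unfolding lp_sum_def using S p
      by (intro arg_cong[where f = "\<lambda>t. t powr (1 / p)"] sum.mono_neutral_right) (auto simp: X_def)
    also have "\<dots> \<le> lp_sum p {..<N l} (\<lambda>n. inverse (\<mu> l) * norm (x l n))"
      using \<mu>(1)[of l] by (intro lp_sum_mono p) (simp add: X_def)
    also have "\<dots> = inverse (\<mu> l) * lp_sum p {..<N l} (x l)"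
      using \<mu>(1)[of l] by (simp add: lp_sum_scale[OF p] lp_sum_norm)
    also have "\<dots> \<le> inverse (\<mu> l) * M l"
      using \<mu>(1)[of l] by (intro mult_left_mono x) simp
    finally show ?thesis by (simp add: divide_inverse mult.commute)
  qed
  have Y_sum: "lp_sum p S Y \<le> R" if "finite S" for S
  proof -
    have "lp_sum p S Y = lp_sum p (prod_decode ` S) (\<lambda>(l, n). X l n)"
      by (subst lp_sum_reindex) (auto simp: Y_def[abs_def] comp_def inj_prod_decode inj_on_subset[OF inj_prod_decode])
    also have "\<dots> \<le> R"
      using that by (intro lp_sum_concatenation_le[OF p X_sum R]) auto
    finally show ?thesis .
  qed
  have Y: "Y \<in> ellp p" "ellp_norm p Y \<le> R"
    by (rule ellpI(1)[OF p Y_sum], assumption) (rule ellpI(2)[OF p Y_sum])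
  have "g k \<in> p_conv p Y" if k: "k \<in> K" for k
  proof -
    define b where "b = (\<lambda>(l, n). of_real (\<mu> l) * s l k n)"
    define a where "a = b \<circ> prod_decode"
    have "b \<in> dual_ball p"
      unfolding b_def using less_imp_le[OF \<mu>(1)] \<mu>(2)
      by (intro dual_ball_convex_concatenation p s(1) k) auto
    then have a: "a \<in> dual_ball p"
      unfolding a_def by (rule dual_ball_reindex) (rule inj_prod_decode)
    have null: "a \<longlonglongrightarrow> 0"
    proof (rule LIMSEQ_I)
      fix e :: real assume e: "0 < e"
      have "summable \<mu>"
        using \<mu> less_imp_le by (intro summableI_nonneg_bounded[of \<mu> 1]) auto
      then have "\<forall>\<^sub>F l in sequentially. \<mu> l < e"
        using order_tendstoD(2)[OF summable_LIMSEQ_zero e] by blast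
      then obtain L where L: "\<And>l. L \<le> l \<Longrightarrow> \<mu> l < e" by (auto simp: eventually_sequentially)
      have small: "norm (b (l, n)) < e" if "(l, n) \<notin> Sigma {..<L} (\<lambda>l. {..<N l})" for l n
      proof (cases "l < L")
        case True
        then show ?thesis using that e s(2)[OF k, of l n] by (simp add: b_def)
      next
        case False
        have "norm (b (l, n)) \<le> \<mu> l * 1"
          using dual_ball_norm_le[OF s(1)[OF k] p, of l n] \<mu>(1)[of l]
          by (simp add: b_def norm_mult mult_left_le)
        then show ?thesis using L[of l] False by simp
      qed
      have "finite (prod_encode ` Sigma {..<L} (\<lambda>l. {..<N l}))" by simp
      then obtain m0 where m0: "prod_encode ` Sigma {..<L} (\<lambda>l. {..<N l}) \<subseteq> {..<m0}"
        using finite_nat_bounded by blast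
      have "norm (a m) < e" if "m0 \<le> m" for m
      proof -
        have "prod_decode m \<notin> Sigma {..<L} (\<lambda>l. {..<N l})"
          using m0 that by (metis imageI lessThan_iff not_le prod_decode_inverse subsetD)
        then show ?thesis using small[of "fst (prod_decode m)" "snd (prod_decode m)"] by (simp add: a_def)
      qed
      then show "\<exists>m0. \<forall>m\<ge>m0. norm (a m - 0) < e" by auto
    qed
    have coeffs: "a \<in> conv_coeffs p"
      by (rule dual_ball_null_subset_conv_coeffs[OF p a null])
    let ?f = "\<lambda>(l, n). b (l, n) *\<^sub>C X l n"
    have aY: "a m *\<^sub>C Y m = ?f (prod_decode m)" for m
      by (simp add: a_def Y_def case_prod_unfold)
    have sm: "summable (\<lambda>m. norm (a m *\<^sub>C Y m))"
      using dual_ball_ellp(1)[OF p a Y(1)] by (simp add: norm_scaleC)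
    define z where "z = (\<Sum>m. a m *\<^sub>C Y m)"
    have z: "((\<lambda>m. a m *\<^sub>C Y m) has_sum z) UNIV"
      unfolding z_def
      by (rule norm_summable_imp_has_sum[OF sm summable_sums[OF summable_norm_cancel[OF sm]]])
    then have zf: "(?f has_sum z) UNIV"
      using has_sum_reindex_bij_betw[OF bij_prod_decode, of ?f z] by (simp add: aY)
    have inner: "((\<lambda>n. ?f (l, n)) has_sum h l k) UNIV" for l
    proof -
      have "((\<lambda>n. ?f (l, n)) has_sum (\<Sum>n<N l. ?f (l, n))) UNIV"
        by (rule has_sum_finite_neutralI[of "{..<N l}"]) (auto simp: X_def)
      also have "(\<Sum>n<N l. ?f (l, n)) = h l k"
        unfolding h[OF k]
      proof (rule sum.cong)
        fix n assume "n \<in> {..<N l}"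
        then show "?f (l, n) = s l k n *\<^sub>C x l n"
          using \<mu>(1)[of l] by (simp add: b_def X_def scaleR_scaleC scaleC_scaleC field_simps)
      qed simp
      finally show ?thesis .
    qed
    have "((\<lambda>l. h l k) has_sum z) UNIV"
    proof (rule has_sum_SigmaD)
      show "(?f has_sum z) (UNIV \<times> UNIV)" using zf by simp
    qed (rule inner)
    then have "z = g k" using sums_unique2[OF has_sum_imp_sums sum[OF k]] by blast
    then have "(\<lambda>m. a m *\<^sub>C Y m) sums g k" using has_sum_imp_sums[OF z] by simp
    with coeffs show ?thesis unfolding p_conv_def by blast
  qed
  with Y show ?thesis by auto
qed

text \<open>
  Split off finite pieces successively. The remainders are dominated with bounds \<open>\<epsilon> l\<close>
  that decrease like \<open>4 ^ (- l)\<close>, so that the pieces after the first can be given weights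
  \<open>\<eta> * 2 ^ (- l)\<close> at a total cost of at most \<open>\<sigma>\<close>. The first piece has the
  weight \<open>1 - \<eta>\<close>, with \<open>\<eta>\<close> chosen so that this enlarges its norm bound
  \<open>M + \<sigma>\<close> to exactly \<open>M + 2 * \<sigma>\<close>.
\<close>

lemma p_dominated_imp_p_conv:
  fixes g :: "'k \<Rightarrow> 'f::complex_banach"
  assumes p: "1 \<le> p" and M: "0 \<le> M" and g: "p_dominated p K M g" and \<tau>: "0 < \<tau>"
  shows "\<exists>x\<in>ellp p. ellp_norm p x \<le> M + \<tau> \<and> g ` K \<subseteq> p_conv p x"
proof -
  define \<sigma> where "\<sigma> = \<tau> / 3"
  have \<sigma>: "0 < \<sigma>" using \<tau> by (simp add: \<sigma>_def)
  define \<eta> where "\<eta> = \<sigma> / (M + 2 * \<sigma>)"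
  have \<eta>: "0 < \<eta>" "\<eta> < 1" "1 - \<eta> = (M + \<sigma>) / (M + 2 * \<sigma>)"
    using M \<sigma> by (auto simp: \<eta>_def field_simps)
  define \<epsilon> where "\<epsilon> l = \<sigma> * \<eta> * (1 / 4) ^ l / 2" for l :: nat
  have \<epsilon>: "0 < \<epsilon> l" "\<epsilon> (Suc l) \<le> \<epsilon> l" for l using \<sigma> \<eta> by (simp_all add: \<epsilon>_def)
  define E where "E l = (if l = 0 then M else \<epsilon> l)" for l :: nat
  have "\<exists>G. \<forall>l. p_dominated p K (E l) (G l) \<and> (l = 0 \<longrightarrow> G l = g) \<and>
      finite_piece p K (E l + \<epsilon> (Suc l)) (\<lambda>k. G l k - G (Suc l) k)"
  proof -
    have "\<exists>G. \<forall>l. (p_dominated p K (E l) (G l) \<and> (l = 0 \<longrightarrow> G l = g)) \<and>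
        finite_piece p K (E l + \<epsilon> (Suc l)) (\<lambda>k. G l k - G (Suc l) k)"
    proof (rule dependent_nat_choice)
      show "\<exists>G. p_dominated p K (E 0) G \<and> (0 = (0::nat) \<longrightarrow> G = g)"
        using g by (auto simp: E_def)
      fix G l assume G: "p_dominated p K (E l) G \<and> (l = 0 \<longrightarrow> G = g)"
      then obtain h where h: "finite_piece p K (E l + \<epsilon> (Suc l)) h"
        "p_dominated p K (\<epsilon> (Suc l)) (\<lambda>k. G k - h k)"
        using split_off_finite_piece[OF p _ \<epsilon>(1)] by metis
      then show "\<exists>G'. (p_dominated p K (E (Suc l)) G' \<and> (Suc l = 0 \<longrightarrow> G' = g)) \<and>
          finite_piece p K (E l + \<epsilon> (Suc l)) (\<lambda>k. G k - G' k)"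
        by (intro exI[of _ "\<lambda>k. G k - h k"]) (simp add: E_def)
    qed
    then show ?thesis by blast
  qed
  then obtain G where G: "\<And>l. p_dominated p K (E l) (G l)" "G 0 = g"
    "\<And>l. finite_piece p K (E l + \<epsilon> (Suc l)) (\<lambda>k. G l k - G (Suc l) k)"
    by blast
  define \<mu> where "\<mu> l = (if l = 0 then 1 - \<eta> else \<eta> * (1 / 2) ^ l)" for l :: nat
  have half: "(\<Sum>l<L. if l = 0 then 0 else (1 / 2) ^ l) \<le> (1::real)" for L :: nat
  proof -
    have "(\<Sum>l<L. if l = 0 then 0 else (1 / 2) ^ l) + (1 / 2 :: real) ^ L * (if L = 0 then 0 else 2) \<le> 1"
      by (induction L) auto
    then show ?thesis by (smt (verit) mult_nonneg_nonneg zero_le_power zero_le_divide_1_iff)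
  qed
  show ?thesis
  proof (rule concatenate_finite_pieces[OF p G(3)])
    show "0 < \<mu> l" for l using \<eta> by (simp add: \<mu>_def)
    show "(\<Sum>l<L. \<mu> l) \<le> 1" for L
    proof -
      have "(\<Sum>l<L. \<mu> l) = (\<Sum>l<L. (if l = 0 then 1 - \<eta> else 0) + \<eta> * (if l = 0 then 0 else (1 / 2) ^ l))"
        by (rule sum.cong) (auto simp: \<mu>_def)
      also have "\<dots> \<le> (1 - \<eta>) + \<eta> * 1"
        unfolding sum.distrib sum_distrib_left[symmetric]
        using \<eta> half by (intro add_mono mult_left_mono) auto
      finally show ?thesis by simp
    qed
    show "(\<Sum>l<L. (E l + \<epsilon> (Suc l)) / \<mu> l) \<le> M + \<tau>" for L
    proof -
      have "(E l + \<epsilon> (Suc l)) / \<mu> l \<le> (if l = 0 then M + 2 * \<sigma> else 0) + \<sigma> * (if l = 0 then 0 else (1 / 2) ^ l)" for l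
      proof (cases "l = 0")
        case True
        have "\<epsilon> (Suc 0) \<le> \<sigma>" using \<sigma> \<eta> by (simp add: \<epsilon>_def mult_left_le)
        then have "(M + \<epsilon> (Suc 0)) / (1 - \<eta>) \<le> (M + \<sigma>) / (1 - \<eta>)"
          using \<eta> by (intro divide_right_mono) auto
        also have "\<dots> = M + 2 * \<sigma>" using M \<sigma> unfolding \<eta>(3) by simp
        finally show ?thesis using True by (simp add: E_def \<mu>_def)
      next
        case False
        have "E l + \<epsilon> (Suc l) \<le> 2 * \<epsilon> l" using False \<epsilon>(2)[of l] by (simp add: E_def)
        also have "\<dots> = (\<sigma> * (1 / 2) ^ l) * \<mu> l"
          using False by (simp add: \<epsilon>_def \<mu>_def flip: power_mult_distrib)
        finally show ?thesis using False \<eta> by (simp add: \<mu>_def pos_divide_le_eq)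
      qed
      then have "(\<Sum>l<L. (E l + \<epsilon> (Suc l)) / \<mu> l)
          \<le> (\<Sum>l<L. (if l = 0 then M + 2 * \<sigma> else 0) + \<sigma> * (if l = 0 then 0 else (1 / 2) ^ l))"
        by (rule sum_mono)
      also have "\<dots> \<le> (M + 2 * \<sigma>) + \<sigma> * 1"
        unfolding sum.distrib sum_distrib_left[symmetric]
        using \<sigma> M half by (intro add_mono mult_left_mono) auto
      finally show ?thesis by (simp add: \<sigma>_def)
    qed
    show "(\<lambda>l. G l k - G (Suc l) k) sums g k" if k: "k \<in> K" for k
    proof -
      have "(\<lambda>l. \<epsilon> l) \<longlonglongrightarrow> 0"
        unfolding \<epsilon>_def by (intro tendsto_eq_intros LIMSEQ_power_zero | simp)+
      moreover have "\<forall>\<^sub>F l in sequentially. norm (G l k) \<le> \<epsilon> l"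
        using eventually_gt_at_top[of 0]
      proof (rule eventually_mono)
        show "norm (G l k) \<le> \<epsilon> l" if "0 < l" for l
          using p_dominated_norm_le[OF p G(1) k, of l] that by (simp add: E_def)
      qed
      ultimately have "(\<lambda>l. G l k) \<longlonglongrightarrow> 0" by (rule Lim_null_comparison[rotated])
      then show ?thesis using telescope_sums'[of "\<lambda>l. G l k" 0] G(2) by simp
    qed
  qed
qed

section \<open>The transpose and the range\<close>

lemma p_conv_imp_dominated:
  fixes x :: "nat \<Rightarrow> 'f::complex_normed_vector"
  assumes p: "1 \<le> p" and x: "x \<in> ellp p" and v: "v \<in> p_conv p x"
  shows "norm (cdual_apply y v) \<le> ellp_norm p (\<lambda>n. cdual_apply y (x n))"
proof -
  obtain a where a: "a \<in> dual_ball p" "(\<lambda>n. a n *\<^sub>C x n) sums v"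
    using v conv_coeffs_subset_dual_ball[OF p] unfolding p_conv_def by blast
  have yx: "(\<lambda>n. cdual_apply y (x n)) \<in> ellp p"
    using norm_cdual_apply_le[of y] by (intro ellp_dominated(1)[OF p x, of "norm y"]) auto
  have "(\<lambda>n. a n * cdual_apply y (x n)) sums cdual_apply y v"
    using bounded_linear.sums[OF bounded_linear_cdual_apply a(2), of y] by (simp add: cdual_apply_scaleC)
  from sums_unique[OF this]
  have "norm (cdual_apply y v) = norm (\<Sum>n. a n * cdual_apply y (x n))"
    by simp
  also have "\<dots> \<le> (\<Sum>n. norm (a n * cdual_apply y (x n)))"
    using dual_ball_ellp(1)[OF p a(1) yx] by (intro summable_norm) (simp add: norm_mult)
  also have "\<dots> \<le> ellp_norm p (\<lambda>n. cdual_apply y (x n))"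
    using dual_ball_ellp(2)[OF p a(1) yx] by (simp add: norm_mult)
  finally show ?thesis .
qed

lemma qn_seqs_transpose_iff:
  assumes f: "f \<in> Hinf U"
  shows "\<phi> \<in> qn_seqs p (transpose_map f) \<longleftrightarrow> \<phi> \<in> ellp p \<and>
    (\<forall>u\<in>U. \<forall>y. norm (cdual_apply y (bddfun_apply f u)) \<le> ellp_norm p (\<lambda>n. cdual_apply (\<phi> n) y))"
proof -
  have "norm (transpose_map f y) \<le> B \<longleftrightarrow> (\<forall>u\<in>U. norm (cdual_apply y (bddfun_apply f u)) \<le> B)"
    if B: "0 \<le> B" for y B
  proof
    assume "norm (transpose_map f y) \<le> B"
    then show "\<forall>u\<in>U. norm (cdual_apply y (bddfun_apply f u)) \<le> B"
      using norm_bddfun_upper[of "transpose_map f y"]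
      by (auto simp: transpose_map.rep_eq intro: order_trans)
  next
    assume *: "\<forall>u\<in>U. norm (cdual_apply y (bddfun_apply f u)) \<le> B"
    show "norm (transpose_map f y) \<le> B"
    proof (rule norm_bddfun_least)
      fix u
      show "norm (bddfun_apply (transpose_map f y) u) \<le> B"
        using * f B by (cases "u \<in> U")
          (auto simp: transpose_map.rep_eq Hinf_def linear_0[OF linear_cdual_apply])
    qed
  qed
  then show ?thesis
    unfolding qn_seqs_def ellp_norm_def[symmetric] by (auto simp: ellp_norm_nonneg)
qed

lemma bounded_clinear_transpose_map:
  fixes f :: "('e, 'f::complex_normed_vector) bddfun"
  shows "bounded_clinear (transpose_map f)"
  unfolding bounded_clinear_def
proof (intro conjI allI)
  show "bounded_linear (transpose_map f)"
  proof (rule bounded_linear_intro[where K = "norm f"])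
    show "transpose_map f (y + z) = transpose_map f y + transpose_map f z" for y z
      by (rule bddfun_eqI) (simp add: transpose_map.rep_eq bddfun_apply_simps cdual_apply_simps)
    show "transpose_map f (r *\<^sub>R y) = r *\<^sub>R transpose_map f y" for r y
      by (rule bddfun_eqI) (simp add: transpose_map.rep_eq bddfun_apply_simps cdual_apply_simps)
    show "norm (transpose_map f y) \<le> norm y * norm f" for y
    proof (rule norm_bddfun_least)
      fix u
      have "norm (cdual_apply y (bddfun_apply f u)) \<le> norm y * norm (bddfun_apply f u)"
        by (rule norm_cdual_apply_le)
      also have "\<dots> \<le> norm y * norm f" by (intro mult_left_mono norm_bddfun_upper) simp
      finally show "norm (bddfun_apply (transpose_map f y) u) \<le> norm y * norm f"
        by (simp add: transpose_map.rep_eq)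
    qed
  qed
  show "transpose_map f (c *\<^sub>C y) = c *\<^sub>C transpose_map f y" for c y
    by (rule bddfun_eqI)
      (simp add: transpose_map.rep_eq bddfun_apply_simps cdual_apply_simps scaleC_complex_def)
qed

theorem theorem1p7:
  fixes U :: "'e::complex_banach set"
    and f :: "('e, 'f::complex_banach) bddfun"
    and p :: real
  assumes "open U" and "1 \<le> p" and "f \<in> Hinf U"
  shows "(rel_p_compact_range p U f \<longleftrightarrow> quasi_p_nuclear p (Hinf U) (transpose_map f))
    \<and> (rel_p_compact_range p U f \<longrightarrow> k_p p U f = nu_Q p (transpose_map f))"
proof -
  note p = \<open>1 \<le> p\<close> and f = \<open>f \<in> Hinf U\<close>
  define A where "A = {x \<in> ellp p. bddfun_apply f ` U \<subseteq> p_conv p x}"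
  define Q where "Q = qn_seqs p (transpose_map f)"
  have AQ: "(\<lambda>n. evaluation (x n)) \<in> Q \<and> ellp_norm p (\<lambda>n. evaluation (x n)) \<le> ellp_norm p x"
    if "x \<in> A" for x
  proof -
    have x: "x \<in> ellp p" "bddfun_apply f ` U \<subseteq> p_conv p x" using that by (auto simp: A_def)
    note ev = ellp_mono[OF p x(1) norm_evaluation_le]
    have "(\<lambda>n. evaluation (x n)) \<in> Q"
      unfolding Q_def qn_seqs_transpose_iff[OF f]
      using ev(1) p_conv_imp_dominated[OF p x(1)] x(2) by auto
    with ev(2) show ?thesis by blast
  qed
  have QA: "\<exists>x\<in>A. ellp_norm p x \<le> ellp_norm p \<phi> + \<tau>" if \<phi>: "\<phi> \<in> Q" and \<tau>: "0 < \<tau>" for \<phi> \<tau>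
  proof -
    have "p_dominated p U (ellp_norm p \<phi>) (bddfun_apply f)"
      using \<phi> unfolding Q_def qn_seqs_transpose_iff[OF f] p_dominated_def by blast
    from p_dominated_imp_p_conv[OF p ellp_norm_nonneg this \<tau>]
    show ?thesis unfolding A_def by blast
  qed
  have compact_iff: "rel_p_compact_range p U f \<longleftrightarrow> A \<noteq> {}"
    by (auto simp: rel_p_compact_range_def rel_p_compact_def A_def)
  have nuclear_iff: "quasi_p_nuclear p (Hinf U) (transpose_map f) \<longleftrightarrow> Q \<noteq> {}"
    using bounded_clinear_transpose_map transpose_map_in_Hinf[OF f]
    by (auto simp: quasi_p_nuclear_def Q_def)
  have iff: "A \<noteq> {} \<longleftrightarrow> Q \<noteq> {}" using AQ QA[OF _ zero_less_one] by blast
  have bdd: "bdd_below (ellp_norm p ` S)" for S :: "(nat \<Rightarrow> 'a::real_normed_vector) set"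
    by (rule bdd_belowI[of _ 0]) (auto simp: ellp_norm_nonneg)
  have "k_p p U f = nu_Q p (transpose_map f)" if ne: "A \<noteq> {}"
  proof (rule antisym)
    have k: "k_p p U f = (INF x\<in>A. ellp_norm p x)" by (simp add: k_p_def m_p_def A_def)
    have nu: "nu_Q p (transpose_map f) = (INF \<phi>\<in>Q. ellp_norm p \<phi>)" by (simp add: nu_Q_def Q_def)
    show "nu_Q p (transpose_map f) \<le> k_p p U f"
      unfolding k nu by (rule cINF_mono[OF ne bdd]) (use AQ in blast)
    show "k_p p U f \<le> nu_Q p (transpose_map f)"
      unfolding k nu
    proof (rule cINF_greatest)
      show "Q \<noteq> {}" using ne iff by blast
      fix \<phi> assume \<phi>: "\<phi> \<in> Q"
      show "(INF x\<in>A. ellp_norm p x) \<le> ellp_norm p \<phi>"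
      proof (rule field_le_epsilon)
        fix \<tau> :: real assume "0 < \<tau>"
        from QA[OF \<phi> this] show "(INF x\<in>A. ellp_norm p x) \<le> ellp_norm p \<phi> + \<tau>"
          using cINF_lower2[OF bdd] by blast
      qed
    qed
  qed
  then show ?thesis unfolding compact_iff nuclear_iff using iff by blast
qed

end
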